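(* Let $d\ge 1$ and let $Y$ be an effective $\mathbb Z^d$-subshift which is not an SFT. Then the equality problem "$Y=X$ on effective inputs $X$" is $\Pi^0_2$-complete.
   Context: For a finite alphabet $\mathcal A$ (a finite subset of $\mathbb N$), a pattern is a function $p\colon S\to\mathcal A$ with $S\subset\mathbb Z^d$ finite; it appears in $x\in\mathcal A^{\mathbb Z^d}$ if there is $u\in\mathbb Z^d$ with $x(u+s)=p(s)$ for all $s\in S$. For a set $\mathcal F$ of patterns, $X_{\mathcal F}$ is the set of configurations in which no pattern from $\mathcal F$ appears. A subshift is a set of the form $X_{\mathcal F}$ (possibly empty); it is an SFT if $\mathcal F$ can be taken finite, and effective if $\mathcal F$ can be taken recursively enumerable. The subshift $Y$ is a fixed parameter. The problem is: given an effective $\mathbb Z^d$-subshift $X$, specified by an alphabet and a Turing machine enumerating a defining set of forbidden patterns, determine whether $X=Y$. Completeness is with respect to many-one reductions. *)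

theory Defs
  imports Complex_Main "HOL-Library.FuncSet" "HOL-Library.Nat_Bijection"
begin

section \<open>Turing machines and computability on the natural numbers\<close>

datatype direction = Left | Right

text \<open>
  A deterministic Turing machine with one two-way infinite tape is given by its finite transition
  table \<open>((state, scanned symbol), (new state, written symbol, direction))\<close>.  States and symbols are
  natural numbers, the initial state is 0, the blank is 0, and the machine halts as soon as no entry
  applies.  The table is read by \<^const>\<open>map_of\<close>: if a pair (state, symbol) occurs more than once, the
  first entry counts, so every table is a deterministic machine.
\<close>

type_synonym tm = "((nat \<times> nat) \<times> (nat \<times> nat \<times> direction)) list"

text \<open>
  A configuration \<open>(q, l, r)\<close>: state \<open>q\<close>, the tape to the left of the head (nearest cell first), and
  the tape from the scanned cell onwards.  All cells beyond the two lists are blank.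
\<close>

type_synonym config = "nat \<times> nat list \<times> nat list"

fun first_symbol :: "nat list \<Rightarrow> nat" where
  "first_symbol [] = 0"
| "first_symbol (a # w) = a"

fun act :: "nat list \<Rightarrow> nat list \<Rightarrow> nat \<times> nat \<times> direction \<Rightarrow> config" where
  "act l r (q, b, Left) = (q, tl l, first_symbol l # b # tl r)"
| "act l r (q, b, Right) = (q, b # l, tl r)"

fun tm_step :: "tm \<Rightarrow> config \<Rightarrow> config option" where
  "tm_step M (q, l, r) = map_option (act l r) (map_of M (q, first_symbol r))"

text \<open>
  Input \<open>n\<close> is the block of \<open>n\<close> strokes (symbol 1), with the head on its leftmost cell; the output is
  the total number of strokes on the tape when the machine halts.
\<close>

definition tm_computes :: "tm \<Rightarrow> nat \<Rightarrow> nat \<Rightarrow> bool" where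
  "tm_computes M n m \<longleftrightarrow>
     (\<exists>q l r. (\<lambda>c c'. tm_step M c = Some c')\<^sup>*\<^sup>* (0, [], replicate n 1) (q, l, r)
        \<and> tm_step M (q, l, r) = None
        \<and> m = count_list l 1 + count_list r 1)"

definition computable :: "(nat \<Rightarrow> nat) \<Rightarrow> bool" where
  "computable f \<longleftrightarrow> (\<exists>M. \<forall>n. tm_computes M n (f n))"

definition decidable :: "nat set \<Rightarrow> bool" where
  "decidable D \<longleftrightarrow> computable (\<lambda>n. if n \<in> D then 1 else 0)"

text \<open>
  The set enumerated by \<open>M\<close>: the range of the partial function that \<open>M\<close> computes.  The function may be
  partial, so that finite sets and the empty set are enumerated as well.
\<close>

definition enumerated :: "tm \<Rightarrow> nat set" where
  "enumerated M = {m. \<exists>n. tm_computes M n m}"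

definition Pi2 :: "nat set \<Rightarrow> bool" where
  "Pi2 B \<longleftrightarrow> (\<exists>D. decidable D \<and> B = {n. \<forall>a. \<exists>b. prod_encode (n, prod_encode (a, b)) \<in> D})"

text \<open>
  Completeness, under many-one reductions, of the problem whose admissible inputs are \<open>I\<close> and whose
  yes-instances are \<open>P\<close>.  Reductions must produce admissible inputs only; with \<open>I = UNIV\<close> this is the
  usual completeness of \<open>P\<close>, and for every \<open>I\<close> it implies it.
\<close>

definition Pi2_complete_on :: "nat set \<Rightarrow> nat set \<Rightarrow> bool" where
  "Pi2_complete_on I P \<longleftrightarrow> P \<subseteq> I \<and> Pi2 P \<and>
     (\<forall>B. Pi2 B \<longrightarrow> (\<exists>f. computable f \<and> range f \<subseteq> I \<and> (\<forall>n. n \<in> B \<longleftrightarrow> f n \<in> P)))"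


section \<open>Subshifts\<close>

text \<open>The group \<open>\<int>\<^sup>d\<close> consists of the integer lists of length \<open>d\<close>.\<close>

type_synonym point = "int list"

definition points :: "nat \<Rightarrow> point set" where
  "points d = {u. length u = d}"

definition shift_by :: "point \<Rightarrow> point \<Rightarrow> point" where
  "shift_by u s = map2 (+) u s"

text \<open>A pattern with support \<open>S\<close> is a partial function with domain \<open>S\<close>.\<close>

type_synonym pattern = "point \<rightharpoonup> nat"

definition patterns :: "nat \<Rightarrow> nat set \<Rightarrow> pattern set" where
  "patterns d A = {p. finite (dom p) \<and> dom p \<subseteq> points d \<and> ran p \<subseteq> A}"

definition configurations :: "nat \<Rightarrow> nat set \<Rightarrow> (point \<Rightarrow> nat) set" where
  "configurations d A = points d \<rightarrow>\<^sub>E A"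

definition appears :: "nat \<Rightarrow> pattern \<Rightarrow> (point \<Rightarrow> nat) \<Rightarrow> bool" where
  "appears d p x \<longleftrightarrow> (\<exists>u\<in>points d. \<forall>s\<in>dom p. Some (x (shift_by u s)) = p s)"

definition avoiding :: "nat \<Rightarrow> nat set \<Rightarrow> pattern set \<Rightarrow> (point \<Rightarrow> nat) set" where
  "avoiding d A F = {x \<in> configurations d A. \<forall>p\<in>F. \<not> appears d p x}"

definition SFT :: "nat \<Rightarrow> (point \<Rightarrow> nat) set \<Rightarrow> bool" where
  "SFT d X \<longleftrightarrow> (\<exists>A F. finite A \<and> F \<subseteq> patterns d A \<and> finite F \<and> X = avoiding d A F)"

text \<open>
  Every number \<open>c\<close> codes a finite partial function, listed by its graph; each finite partial function
  has a code.  As before, the first entry for a point counts.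
\<close>

definition pattern_of :: "nat \<Rightarrow> pattern" where
  "pattern_of c = map_of (map (\<lambda>e. case prod_decode e of (s, a) \<Rightarrow>
                                 (map int_decode (list_decode s), a))
                            (list_decode c))"

definition enumerated_patterns :: "tm \<Rightarrow> pattern set" where
  "enumerated_patterns M = pattern_of ` enumerated M"

text \<open>\<open>(A, M)\<close> specifies an effective subshift: \<open>M\<close> enumerates a set of patterns over \<open>A\<close>.\<close>

definition specifies :: "nat \<Rightarrow> nat set \<Rightarrow> tm \<Rightarrow> bool" where
  "specifies d A M \<longleftrightarrow> finite A \<and> enumerated_patterns M \<subseteq> patterns d A"

definition subshift_of :: "nat \<Rightarrow> nat set \<Rightarrow> tm \<Rightarrow> (point \<Rightarrow> nat) set" where
  "subshift_of d A M = avoiding d A (enumerated_patterns M)"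

definition effective :: "nat \<Rightarrow> (point \<Rightarrow> nat) set \<Rightarrow> bool" where
  "effective d X \<longleftrightarrow> (\<exists>A M. specifies d A M \<and> X = subshift_of d A M)"


section \<open>The equality problem\<close>

fun direction_code :: "direction \<Rightarrow> nat" where
  "direction_code Left = 0"
| "direction_code Right = 1"

definition tm_code :: "tm \<Rightarrow> nat" where
  "tm_code M = list_encode (map (\<lambda>((q, a), (q', b, D)).
       prod_encode (prod_encode (q, a), prod_encode (q', prod_encode (b, direction_code D)))) M)"

definition input_code :: "nat set \<Rightarrow> tm \<Rightarrow> nat" where
  "input_code A M = prod_encode (set_encode A, tm_code M)"

definition effective_inputs :: "nat \<Rightarrow> nat set" where
  "effective_inputs d = {input_code A M | A M. specifies d A M}"

definition equality_problem :: "nat \<Rightarrow> (point \<Rightarrow> nat) set \<Rightarrow> nat set" where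
  "equality_problem d Y = {input_code A M | A M. specifies d A M \<and> subshift_of d A M = Y}"

end

theory Submission
  imports Defs
begin

text \<open>
  Upper bound: \<open>X \<subseteq> Y\<close> holds iff every forbidden pattern of \<open>Y\<close> is excluded in \<open>X\<close>, and by compactness
  exclusion of a pattern has a finite certificate. Hence \<open>X = Y\<close> is of the form
  \<open>\<forall>\<exists>\<close> with a decidable matrix.

  Lower bound: let \<open>p\<^sub>0, p\<^sub>1, \<dots>\<close> be the forbidden patterns of \<open>Y\<close>. Given a condition
  \<open>\<forall>a. \<exists>b. D n a b\<close>, forbid \<open>p\<^sub>i\<close> as soon as witnesses \<open>b\<close> have been found for all \<open>a \<le> i\<close>. If the
  condition holds, the resulting subshift is \<open>Y\<close>; otherwise only finitely many patterns are forbidden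
  and the result is an SFT, hence different from \<open>Y\<close>.

  All functions needed are primitive recursive: bounding the simulation time and falling
  back to one fixed pattern \<open>p\<close> of \<open>Y\<close> makes the enumeration total. It thus suffices to compile
  programs for such functions to Turing machines, one of them with a parameter.
\<close>

section \<open>Register programs on Turing machines\<close>

text \<open>One subshift can be specified over different alphabets, so inclusion has a second way to
  fail: a symbol missing from the other alphabet. Symbols are therefore excluded by certificates
  just like patterns. Admissibility of an input also has to be verified in the upper bound: that all
  outputs are patterns over the alphabet is a universal statement about runs, and the outer
  quantifier absorbs it.

  Testing all \<open>a\<close> \<le> \<open>i\<close>, and not \<open>i\<close> alone, makes the
  lower bound work: one bad \<open>a\<close> then blocks all but finitely many patterns, whereas
  losing the single pattern of index \<open>a\<close> might leave the subshift unchanged.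

  Unbounded search is never programmed. Its bounds become quantified variables in the upper bound
  and arguments of the enumerating machine in the lower bound; decidable sets, which need not be
  primitive recursive, enter through time-bounded simulation. No universal machine occurs: the
  machines that the reduction outputs differ only in a chain of states writing the parameter and in
  the entry into this chain.\<close>

datatype prog = Inc nat | Dec nat | Seq prog prog | While nat prog

inductive exec :: "prog \<Rightarrow> (nat \<Rightarrow> nat) \<Rightarrow> (nat \<Rightarrow> nat) \<Rightarrow> bool" where
  Inc: "exec (Inc r) s (s(r := Suc (s r)))"
| Dec: "exec (Dec r) s (s(r := s r - 1))"
| Seq: "exec p s t \<Longrightarrow> exec q t u \<Longrightarrow> exec (Seq p q) s u"
| While_False: "s r = 0 \<Longrightarrow> exec (While r p) s s"
| While_True: "s r \<noteq> 0 \<Longrightarrow> exec p s t \<Longrightarrow> exec (While r p) t u \<Longrightarrow> exec (While r p) s u"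

text \<open>This many tracks on the tape suffice for the program.\<close>

fun bound :: "prog \<Rightarrow> nat" where
  "bound (Inc r) = Suc r"
| "bound (Dec r) = Suc r"
| "bound (Seq p q) = max (bound p) (bound q)"
| "bound (While r p) = max (Suc r) (bound p)"

text \<open>Cells beyond the end of the list are blank, so lists are compared up to trailing
  blanks.\<close>

definition nth0 :: "nat list \<Rightarrow> nat \<Rightarrow> nat" where
  "nth0 w i = (if i < length w then w ! i else 0)"

lemma nth0_Nil [simp]: "nth0 [] i = 0"
  by (simp add: nth0_def)

lemma nth0_Cons [simp]: "nth0 (a # w) 0 = a" "nth0 (a # w) (Suc i) = nth0 w i"
  by (simp_all add: nth0_def)

lemma nth0_tl: "nth0 (tl w) i = nth0 w (Suc i)"
  by (cases w) auto

lemma first_symbol_nth0: "first_symbol w = nth0 w 0"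
  by (cases w) auto

text \<open>
  Only the part of the tape to the right of the initial left end is ever used, so a tape is a
  function on the natural numbers and the head has a position \<open>p\<close>.
\<close>

fun represents :: "config \<Rightarrow> nat \<times> (nat \<Rightarrow> nat) \<times> nat \<Rightarrow> bool" where
  "represents (q, l, r) (q', t, p) \<longleftrightarrow>
     q = q' \<and> l = rev (map t [0..<p]) \<and> (\<forall>i. nth0 r i = t (p + i))"

definition steps :: "tm \<Rightarrow> config \<Rightarrow> config \<Rightarrow> bool" where
  "steps M = (\<lambda>c c'. tm_step M c = Some c')\<^sup>*\<^sup>*"

text \<open>A tape has several representations, differing in trailing blanks on the right.
  Quantifying over all of them makes the relation transitive.\<close>

definition reach :: "tm \<Rightarrow> nat \<times> (nat \<Rightarrow> nat) \<times> nat \<Rightarrow> nat \<times> (nat \<Rightarrow> nat) \<times> nat \<Rightarrow> bool" where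
  "reach M a b \<longleftrightarrow> (\<forall>c. represents c a \<longrightarrow> (\<exists>c'. steps M c c' \<and> represents c' b))"

lemma reach_refl: "reach M a a"
  unfolding reach_def steps_def by blast

lemma reach_trans [trans]: "reach M a b \<Longrightarrow> reach M b c \<Longrightarrow> reach M a c"
  unfolding reach_def steps_def by (meson rtranclp_trans)

text \<open>In a single-valued table the order of entries is irrelevant. Subprograms can thus be
  treated as subsets of the whole table.\<close>

lemma map_of_single_valued:
  assumes "single_valued (set M)" "(k, v) \<in> set M"
  shows "map_of M k = Some v"
  using assms by (metis map_of_SomeD single_valuedD weak_map_of_SomeI)

lemma steps_step: "tm_step M c = Some c' \<Longrightarrow> steps M c c'"
  unfolding steps_def by blast

lemma reach_Right:
  assumes "single_valued (set M)" "((q, t p), (q', b, Right)) \<in> set M"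
  shows "reach M (q, t, p) (q', t(p := b), Suc p)"
  unfolding reach_def
proof (intro allI impI)
  fix c assume c: "represents c (q, t, p)"
  obtain l r where c_eq: "c = (q, l, r)" and l: "l = rev (map t [0..<p])"
    and r: "\<And>i. nth0 r i = t (p + i)"
    using c by (cases c) auto
  have "first_symbol r = t p"
    using r[of 0] by (simp add: first_symbol_nth0)
  then have "tm_step M c = Some (q', b # l, tl r)"
    using map_of_single_valued[OF assms] by (simp add: c_eq)
  moreover have "represents (q', b # l, tl r) (q', t(p := b), Suc p)"
    using r by (auto simp: l nth0_tl)
  ultimately show "\<exists>c'. steps M c c' \<and> represents c' (q', t(p := b), Suc p)"
    using steps_step by blast
qed

lemma reach_Left:
  assumes "single_valued (set M)" "((q, t (Suc p)), (q', b, Left)) \<in> set M"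
  shows "reach M (q, t, Suc p) (q', t(Suc p := b), p)"
  unfolding reach_def
proof (intro allI impI)
  fix c assume c: "represents c (q, t, Suc p)"
  obtain l r where c_eq: "c = (q, l, r)" and l: "l = rev (map t [0..<Suc p])"
    and r: "\<And>i. nth0 r i = t (Suc p + i)"
    using c by (cases c) auto
  have "first_symbol r = t (Suc p)"
    using r[of 0] by (simp add: first_symbol_nth0)
  then have "tm_step M c = Some (q', tl l, first_symbol l # b # tl r)"
    using map_of_single_valued[OF assms] by (simp add: c_eq)
  moreover have "nth0 (first_symbol l # b # tl r) i = (t(Suc p := b)) (p + i)" for i
  proof (cases i)
    case (Suc j)
    then show ?thesis using r by (cases j) (auto simp: nth0_tl)
  qed (simp add: l)
  then have "represents (q', tl l, first_symbol l # b # tl r) (q', t(Suc p := b), p)"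
    by (auto simp: l)
  ultimately show "\<exists>c'. steps M c c' \<and> represents c' (q', t(Suc p := b), p)"
    using steps_step by blast
qed

lemma reach_Right_same:
  "single_valued (set M) \<Longrightarrow> ((q, t p), (q', t p, Right)) \<in> set M \<Longrightarrow>
    reach M (q, t, p) (q', t, Suc p)"
  using reach_Right[of M q t p q' "t p"] by simp

lemma reach_Left_same:
  "single_valued (set M) \<Longrightarrow> ((q, t (Suc p)), (q', t (Suc p), Left)) \<in> set M \<Longrightarrow>
    reach M (q, t, Suc p) (q', t, p)"
  using reach_Left[of M q t p q' "t (Suc p)"] by simp

subsection \<open>Registers as tracks of the tape\<close>

definition column :: "nat \<Rightarrow> (nat \<Rightarrow> nat) \<Rightarrow> nat \<Rightarrow> nat set" where
  "column m s i = {r. r < m \<and> i < s r}"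

text \<open>
  Cell \<open>i + 1\<close> carries the set of the registers with contents greater than \<open>i\<close>; cell 0 carries the
  end marker \<open>2 ^ m\<close>.  Register 0 alone thus appears as a block of strokes, as in the input and
  output conventions of the machines.
\<close>

definition tape :: "nat \<Rightarrow> (nat \<Rightarrow> nat) \<Rightarrow> nat \<Rightarrow> nat" where
  "tape m s p = (case p of 0 \<Rightarrow> 2 ^ m | Suc i \<Rightarrow> set_encode (column m s i))"

lemma tape_0 [simp]: "tape m s 0 = 2 ^ m"
  and tape_Suc [simp]: "tape m s (Suc i) = set_encode (column m s i)"
  by (simp_all add: tape_def)

lemma finite_column [simp]: "finite (column m s i)"
  by (simp add: column_def)

lemma set_encode_less:
  assumes "S \<subseteq> {..<m}"
  shows "set_encode S < 2 ^ m"
proof -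
  have "set_encode S \<le> (\<Sum>i<m. 2 ^ i)"
    unfolding set_encode_def by (rule sum_mono2) (use assms in auto)
  also have "\<dots> = 2 ^ m - 1"
    using sum_power2[of m] by (simp add: atLeast0LessThan)
  also have "\<dots> < 2 ^ m" by simp
  finally show ?thesis .
qed

lemma column_less [simp]: "set_encode (column m s i) < 2 ^ m"
  by (rule set_encode_less) (auto simp: column_def)

lemma in_column: "r < m \<Longrightarrow> r \<in> column m s i \<longleftrightarrow> i < s r"
  by (simp add: column_def)

text \<open>The symbols below \<open>2 ^ m\<close> are the bit codes of the sets of tracks. The end
  marker \<open>2 ^ m\<close> is none of them and needs entries of its own.\<close>

definition row :: "nat \<Rightarrow> nat \<Rightarrow> nat \<Rightarrow> (nat set \<Rightarrow> bool) \<Rightarrow> (nat set \<Rightarrow> nat set) \<Rightarrow> direction \<Rightarrow> tm" where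
  "row m q q' P f D = map (\<lambda>a. ((q, a), (q', set_encode (f (set_decode a)), D)))
     (filter (\<lambda>a. P (set_decode a)) [0..<2 ^ m])"

lemma set_row:
  "set (row m q q' P f D) =
    {((q, a), (q', set_encode (f (set_decode a)), D)) | a. a < 2 ^ m \<and> P (set_decode a)}"
  by (auto simp: row_def)

lemma row_mem:
  assumes "set (row m q q' P f D) \<subseteq> T" "P (column m s i)"
  shows "((q, tape m s (Suc i)), (q', set_encode (f (column m s i)), D)) \<in> T"
proof -
  have "((q, set_encode (column m s i)), (q', set_encode (f (column m s i)), D))
      \<in> set (row m q q' P f D)"
    unfolding set_row
    by (rule CollectI, rule exI[of _ "set_encode (column m s i)"])
      (use assms(2) in \<open>simp add: set_encode_inverse\<close>)
  then show ?thesis using assms(1) by auto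
qed

fun size_states :: "prog \<Rightarrow> nat" where
  "size_states (Inc r) = 2"
| "size_states (Dec r) = 3"
| "size_states (Seq p q) = size_states p + size_states q"
| "size_states (While r p) = 3 + size_states p"

text \<open>
  \<open>compile m q e p\<close> starts in state \<open>q\<close> and ends in state \<open>e\<close>, in both cases with the head on
  cell 1; its own states are the \<open>size_states p\<close> many from \<open>q\<close> on.
\<close>

fun compile :: "nat \<Rightarrow> nat \<Rightarrow> nat \<Rightarrow> prog \<Rightarrow> tm" where
  "compile m q e (Inc r) =
     row m q q (\<lambda>S. r \<in> S) id Right @ row m q (q + 1) (\<lambda>S. r \<notin> S) (insert r) Left @
     row m (q + 1) (q + 1) (\<lambda>S. True) id Left @ [((q + 1, 2 ^ m), (e, 2 ^ m, Right))]"
| "compile m q e (Dec r) =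
     row m q q (\<lambda>S. r \<in> S) id Right @ row m q (q + 1) (\<lambda>S. r \<notin> S) id Left @
     row m (q + 1) (q + 2) (\<lambda>S. True) (\<lambda>S. S - {r}) Left @ [((q + 1, 2 ^ m), (e, 2 ^ m, Right))] @
     row m (q + 2) (q + 2) (\<lambda>S. True) id Left @ [((q + 2, 2 ^ m), (e, 2 ^ m, Right))]"
| "compile m q e (Seq p1 p2) =
     compile m q (q + size_states p1) p1 @ compile m (q + size_states p1) e p2"
| "compile m q e (While r p) =
     row m q (q + 1) (\<lambda>S. r \<in> S) id Left @ row m q (q + 2) (\<lambda>S. r \<notin> S) id Left @
     [((q + 1, 2 ^ m), (q + 3, 2 ^ m, Right)), ((q + 2, 2 ^ m), (e, 2 ^ m, Right))] @
     compile m (q + 3) q p"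

text \<open>Distinct subprograms own disjoint intervals of states. This yields single-valuedness
  and, for the exit state of the whole program, halting.\<close>

lemma compile_states:
  "((q', a), v) \<in> set (compile m q e p) \<Longrightarrow> q \<le> q' \<and> q' < q + size_states p"
proof (induction p arbitrary: q e)
  case (Seq p1 p2)
  then show ?case by fastforce
next
  case (While r p)
  from While.prems consider "((q', a), v) \<in> set (compile m (q + 3) q p)"
    | "q \<le> q' \<and> q' < q + 3"
    by (auto simp: set_row)
  then show ?case using While.IH by cases fastforce+
qed (auto simp: set_row)

lemma single_valued_Un:
  assumes "single_valued S" "single_valued T" "\<And>k v w. (k, v) \<in> S \<Longrightarrow> (k, w) \<in> T \<Longrightarrow> False"
  shows "single_valued (S \<union> T)"
  using assms unfolding single_valued_def by blast

lemma compile_single_valued: "single_valued (set (compile m q e p))"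
proof (induction p arbitrary: q e)
  case (Seq p1 p2)
  show ?case unfolding compile.simps set_append
    by (rule single_valued_Un[OF Seq.IH]) (auto dest!: compile_states)
next
  case (While r p)
  have "single_valued (set (row m q (q + 1) (\<lambda>S. r \<in> S) id Left @ row m q (q + 2) (\<lambda>S. r \<notin> S) id Left @
     [((q + 1, 2 ^ m), (q + 3, 2 ^ m, Right)), ((q + 2, 2 ^ m), (e, 2 ^ m, Right))]))"
    by (auto simp: single_valued_def set_row)
  then have "single_valued (set (row m q (q + 1) (\<lambda>S. r \<in> S) id Left @ row m q (q + 2) (\<lambda>S. r \<notin> S) id Left @
     [((q + 1, 2 ^ m), (q + 3, 2 ^ m, Right)), ((q + 2, 2 ^ m), (e, 2 ^ m, Right))])
     \<union> set (compile m (q + 3) q p))"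
    by (rule single_valued_Un[OF _ While.IH]) (auto dest!: compile_states simp: set_row)
  then show ?case by (simp add: Un_assoc insert_commute)
qed (auto simp: single_valued_def set_row)

section \<open>Correctness of compiled programs\<close>

lemma reach_return:
  assumes M: "single_valued (set M)"
    and sub: "set (row m q q (\<lambda>S. True) id Left) \<subseteq> set M" "((q, 2 ^ m), (e, 2 ^ m, Right)) \<in> set M"
  shows "reach M (q, tape m s, p) (e, tape m s, 1)"
proof (induction p)
  case 0
  show ?case using reach_Right_same[OF M, of q "tape m s" 0 e] sub(2) by simp
next
  case (Suc p)
  have "reach M (q, tape m s, Suc p) (q, tape m s, p)"
    by (rule reach_Left_same[OF M]) (use row_mem[OF sub(1), of s p] in simp)
  then show ?case using Suc by (rule reach_trans)
qed

lemma reach_scan: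
  assumes M: "single_valued (set M)" and r: "r < m"
    and sub: "set (row m q q (\<lambda>S. r \<in> S) id Right) \<subseteq> set M"
  shows "k \<le> s r \<Longrightarrow> reach M (q, tape m s, 1) (q, tape m s, Suc k)"
proof (induction k)
  case 0
  show ?case by (simp add: reach_refl)
next
  case (Suc k)
  have "reach M (q, tape m s, Suc k) (q, tape m s, Suc (Suc k))"
    by (rule reach_Right_same[OF M])
      (use row_mem[OF sub, of s k] Suc.prems r in \<open>simp add: in_column\<close>)
  then show ?case using Suc by (meson Suc_leD reach_trans)
qed

lemma tape_Inc:
  assumes "r < m"
  shows "(tape m s)(Suc (s r) := set_encode (insert r (column m s (s r)))) = tape m (s(r := Suc (s r)))"
proof
  fix p
  have "column m (s(r := Suc (s r))) i = (if i = s r then insert r (column m s i) else column m s i)" for i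
    using assms by (auto simp: column_def)
  then show "((tape m s)(Suc (s r) := set_encode (insert r (column m s (s r))))) p = tape m (s(r := Suc (s r))) p"
    by (cases p) auto
qed

lemma tape_Dec:
  assumes "r < m" "s r = Suc k"
  shows "(tape m s)(Suc k := set_encode (column m s k - {r})) = tape m (s(r := k))"
proof
  fix p
  have "column m (s(r := k)) i = (if i = k then column m s i - {r} else column m s i)" for i
    using assms by (auto simp: column_def)
  then show "((tape m s)(Suc k := set_encode (column m s k - {r}))) p = tape m (s(r := k)) p"
    by (cases p) auto
qed

text \<open>Position \<open>Suc (s r)\<close> is the first cell to the right of the marker whose
  track \<open>r\<close> is empty: \<open>Inc\<close> fills it, \<open>Dec\<close> overshoots to it
  and erases in the cell before. The table \<open>M\<close> is fixed throughout the induction and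
  only has to contain the code of the subprogram.\<close>

lemma compile_correct:
  assumes M: "single_valued (set M)"
  shows "exec p s s' \<Longrightarrow> bound p \<le> m \<Longrightarrow> set (compile m q e p) \<subseteq> set M \<Longrightarrow>
    reach M (q, tape m s, 1) (e, tape m s', 1)"
proof (induction p s s' arbitrary: q e rule: exec.induct)
  case (Inc r s)
  let ?t = "tape m (s(r := Suc (s r)))"
  have r: "r < m" using Inc by simp
  have "reach M (q, tape m s, 1) (q, tape m s, Suc (s r))"
    by (rule reach_scan[OF M r]) (use Inc in auto)
  also have "reach M (q, tape m s, Suc (s r)) (q + 1, ?t, s r)"
  proof -
    have "((q, tape m s (Suc (s r))), (q + 1, set_encode (insert r (column m s (s r))), Left)) \<in> set M"
      by (rule row_mem[where P = "\<lambda>S. r \<notin> S" and f = "insert r"]) (use Inc r in \<open>auto simp: in_column\<close>)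
    from reach_Left[where t = "tape m s", OF M this] show ?thesis by (simp only: tape_Inc[OF r])
  qed
  also have "reach M (q + 1, ?t, s r) (e, ?t, 1)"
    by (rule reach_return[OF M]) (use Inc in auto)
  finally show ?case .
next
  case (Dec r s)
  let ?t = "tape m (s(r := s r - 1))"
  have r: "r < m" using Dec by simp
  have "reach M (q, tape m s, 1) (q, tape m s, Suc (s r))"
    by (rule reach_scan[OF M r]) (use Dec in auto)
  also have "reach M (q, tape m s, Suc (s r)) (q + 1, tape m s, s r)"
  proof -
    have "((q, tape m s (Suc (s r))), (q + 1, set_encode (id (column m s (s r))), Left)) \<in> set M"
      by (rule row_mem[where P = "\<lambda>S. r \<notin> S" and f = id]) (use Dec r in \<open>auto simp: in_column\<close>)
    then show ?thesis using reach_Left_same[OF M, of q "tape m s" "s r"] by simp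
  qed
  \<comment> \<open>After the step back the head is at position \<open>s r\<close>. It sees the
    marker exactly if the register is empty, and then nothing is erased.\<close>
  also have "reach M (q + 1, tape m s, s r) (e, ?t, 1)"
  proof (cases "s r")
    case 0
    then show ?thesis
      using reach_Right_same[OF M, of "q + 1" "tape m s" 0 e] Dec by (simp add: fun_upd_idem)
  next
    case (Suc k)
    have "((q + 1, tape m s (Suc k)), (q + 2, set_encode (column m s k - {r}), Left)) \<in> set M"
      by (rule row_mem[where P = "\<lambda>S. True" and f = "\<lambda>S. S - {r}"]) (use Dec in auto)
    from reach_Left[where t = "tape m s", OF M this]
    have "reach M (q + 1, tape m s, Suc k) (q + 2, ?t, k)"
      by (simp only: tape_Dec[where s = s, OF r Suc]) (simp add: Suc)
    also have "reach M (q + 2, ?t, k) (e, ?t, 1)"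
      by (rule reach_return[OF M]) (use Dec in auto)
    finally show ?thesis by (simp add: Suc)
  qed
  finally show ?case .
next
  case (Seq p1 s t p2 u)
  have "reach M (q, tape m s, 1) (q + size_states p1, tape m t, 1)"
    by (rule Seq.IH(1)) (use Seq.prems in auto)
  also have "reach M \<dots> (e, tape m u, 1)"
    by (rule Seq.IH(2)) (use Seq.prems in auto)
  finally show ?case .
next
  case (While_False s r p)
  have r: "r < m" using While_False by simp
  \<comment> \<open>Cell 1 alone decides the test. As every transition moves the head, the machine
    goes to the marker and back, remembering the outcome in its state.\<close>
  have "((q, tape m s (Suc 0)), (q + 2, set_encode (id (column m s 0)), Left)) \<in> set M"
    by (rule row_mem[where P = "\<lambda>S. r \<notin> S" and f = id]) (use While_False r in \<open>auto simp: in_column\<close>)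
  then have "reach M (q, tape m s, 1) (q + 2, tape m s, 0)"
    using reach_Left_same[OF M, of q "tape m s" 0] by simp
  also have "reach M \<dots> (e, tape m s, 1)"
    using reach_Right_same[OF M, of "q + 2" "tape m s" 0 e] While_False by simp
  finally show ?case .
next
  case (While_True s r p t u)
  have r: "r < m" using While_True by simp
  have "((q, tape m s (Suc 0)), (q + 1, set_encode (id (column m s 0)), Left)) \<in> set M"
    by (rule row_mem[where P = "\<lambda>S. r \<in> S" and f = id]) (use While_True r in \<open>auto simp: in_column\<close>)
  then have "reach M (q, tape m s, 1) (q + 1, tape m s, 0)"
    using reach_Left_same[OF M, of q "tape m s" 0] by simp
  also have "reach M \<dots> (q + 3, tape m s, 1)"
    using reach_Right_same[OF M, of "q + 1" "tape m s" 0 "q + 3"] While_True.prems by simp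
  also have "reach M \<dots> (q, tape m t, 1)"
    by (rule While_True.IH(1)) (use While_True.prems in auto)
  also have "reach M \<dots> (e, tape m u, 1)"
    by (rule While_True.IH(2)) (use While_True.prems in auto)
  finally show ?case .
qed

subsection \<open>Machines with a parameter\<close>

text \<open>
  The parametrised machine writes the marker, then \<open>n\<close> into track 1 (adding 2 to the symbols 0 and 1),
  returns to cell 1 and runs the compiled program.
\<close>

definition write_state :: "prog \<Rightarrow> nat \<Rightarrow> nat" where
  "write_state p k = 4 + size_states p + k"

text \<open>Recursion on \<open>n\<close> keeps the code of the table primitive recursive in
  \<open>n\<close>. In state \<open>write_state p k\<close> there are \<open>k\<close> strokes left
  to write.\<close>

definition write_parameter :: "prog \<Rightarrow> nat \<Rightarrow> tm" where
  "write_parameter p n = rec_nat [] (\<lambda>k T.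
     ((write_state p (Suc k), 0), (write_state p k, 2, Right)) #
     ((write_state p (Suc k), 1), (write_state p k, 3, Right)) # T) n"

text \<open>The input starts at the scanned cell, so state 0 steps left to gain a cell for the
  marker. State \<open>write_state p 0\<close> turns around, and state 2 runs back to the
  marker.\<close>

definition fixed_part :: "nat \<Rightarrow> prog \<Rightarrow> tm" where
  "fixed_part m p = [((0, 0), (1, 0, Left)), ((0, 1), (1, 1, Left)),
       ((write_state p 0, 0), (2, 0, Left)), ((write_state p 0, 1), (2, 1, Left))] @
     row m 2 2 (\<lambda>S. True) id Left @ [((2, 2 ^ m), (3, 2 ^ m, Right))] @
     compile m 3 (3 + size_states p) p"

definition parametrised :: "nat \<Rightarrow> prog \<Rightarrow> nat \<Rightarrow> tm" where
  "parametrised m p n = ((1, 0), (write_state p n, 2 ^ m, Right)) # write_parameter p n @ fixed_part m p"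

lemma set_write_parameter:
  "set (write_parameter p n) =
    {((write_state p (Suc k), a), (write_state p k, a + 2, Right)) | k a. k < n \<and> a < 2}"
proof (induction n)
  case (Suc n)
  have "set (write_parameter p (Suc n)) = set (write_parameter p n) \<union>
      {((write_state p (Suc n), 0), (write_state p n, 2, Right)),
       ((write_state p (Suc n), 1), (write_state p n, 3, Right))}"
    by (auto simp: write_parameter_def)
  also have "\<dots> = {((write_state p (Suc k), a), (write_state p k, a + 2, Right)) | k a. k < Suc n \<and> a < 2}"
    unfolding Suc by (auto simp: less_Suc_eq less_2_cases_iff)
  finally show ?case .
qed (simp add: write_parameter_def)

lemma parametrised_single_valued: "single_valued (set (parametrised m p n))"
proof -
  have 1: "single_valued (set [((0, 0), (1, 0, Left)), ((0, 1), (1, 1, Left)),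
       ((write_state p 0, 0), (2, 0, Left)), ((write_state p 0, 1), (2, 1, Left))]
     \<union> (set (row m 2 2 (\<lambda>S. True) id Left @ [((2, 2 ^ m), (3, 2 ^ m, Right))])
     \<union> set (compile m 3 (3 + size_states p) p)))"
    by (intro single_valued_Un compile_single_valued)
      (auto dest!: compile_states simp: single_valued_def set_row write_state_def)
  have 2: "single_valued (insert ((1, 0), (write_state p n, 2 ^ m, Right)) (set (write_parameter p n)))"
    by (auto simp: single_valued_def set_write_parameter write_state_def)
  have "single_valued (insert ((1, 0), (write_state p n, 2 ^ m, Right)) (set (write_parameter p n)) \<union>
      set (fixed_part m p))"
    using 1 unfolding fixed_part_def set_append Un_assoc
    by (intro single_valued_Un[OF 2])
      (auto dest!: compile_states simp: set_row set_write_parameter write_state_def)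
  then show ?thesis by (simp add: parametrised_def)
qed

lemma count_strokes:
  assumes "\<And>i. nth0 r i = (if i < k then 1 else 0)"
  shows "count_list r 1 = k"
  using assms
proof (induction r arbitrary: k)
  case Nil
  show ?case using Nil[of 0] by (cases k) auto
next
  case (Cons a r)
  have "a = (if 0 < k then 1 else 0)" using Cons.prems[of 0] by simp
  moreover have "count_list r 1 = k - 1"
    by (rule Cons.IH) (use Cons.prems[of "Suc _"] in auto)
  ultimately show ?case by auto
qed

lemma parametrised_computes:
  assumes exec: "exec p ((\<lambda>_. 0)(0 := j, 1 := n)) ((\<lambda>_. 0)(0 := v))"
    and m: "bound p \<le> m" "2 \<le> m"
  shows "tm_computes (parametrised m p n) j v"
proof -
  let ?M = "parametrised m p n"
  define s :: "nat \<Rightarrow> nat \<Rightarrow> nat" where "s k = (\<lambda>_. 0)(0 := j, 1 := k)" for k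
  let ?e = "3 + size_states p"
  have M: "single_valued (set ?M)" by (rule parametrised_single_valued)
  have fixed: "set (fixed_part m p) \<subseteq> set ?M" and param: "set (write_parameter p n) \<subseteq> set ?M"
    by (auto simp: parametrised_def)
  have "column m (s k) i = (if i < j then {0} else {}) \<union> (if i < k then {1} else {})" for i k
    using m(2) by (auto simp: column_def s_def)
  then have cell: "set_encode (column m (s k) i) = (if i < j then 1 else 0) + (if i < k then 2 else 0)" for i k
    by (auto simp: set_encode_def)
  define w where "w = (replicate j 1 :: nat list)"
  have w: "nth0 w i = (if i < j then 1 else 0)" for i
    by (simp add: w_def nth0_def)
  have first: "first_symbol w = (if 0 < j then 1 else 0)"
    by (simp add: first_symbol_nth0 w)
  \<comment> \<open>The scanned symbol is rewritten, so the right part becomes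
    \<open>first_symbol w # tl w\<close>; for \<open>j = 0\<close> this differs from
    \<open>w\<close> by an explicit blank.\<close>
  have "((0, first_symbol w), (1, first_symbol w, Left)) \<in> set ?M"
    using fixed first by (auto simp: fixed_part_def)
  then have "tm_step ?M (0, [], w) = Some (1, [], 0 # first_symbol w # tl w)"
    using map_of_single_valued[OF M] by simp
  then have start1: "steps ?M (0, [], w) (1, [], 0 # first_symbol w # tl w)"
    by (rule steps_step)
  have "((1, 0), (write_state p n, 2 ^ m, Right)) \<in> set ?M"
    by (simp add: parametrised_def)
  then have "tm_step ?M (1, [], 0 # first_symbol w # tl w)
      = Some (write_state p n, [2 ^ m], first_symbol w # tl w)"
    using map_of_single_valued[OF M] by simp
  then have start2: "steps ?M (0, [], w) (write_state p n, [2 ^ m], first_symbol w # tl w)"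
    using start1 unfolding steps_def by (rule rtranclp.rtrancl_into_rtrancl[rotated])
  have rep: "represents (write_state p n, [2 ^ m], first_symbol w # tl w)
      (write_state p n, tape m (s 0), 1)"
  proof -
    have "nth0 (first_symbol w # tl w) i = tape m (s 0) (1 + i)" for i
      by (cases i) (simp_all add: nth0_tl first w cell)
    then show ?thesis by simp
  qed
  \<comment> \<open>After \<open>k\<close> steps, \<open>k\<close> strokes are on track 1 and the
    state counts the remaining \<open>n - k\<close>.\<close>
  have writing: "k \<le> n \<Longrightarrow> reach ?M (write_state p n, tape m (s 0), 1)
      (write_state p (n - k), tape m (s k), Suc k)" for k
  proof (induction k)
    case 0
    show ?case by (simp add: reach_refl)
  next
    case (Suc k)
    let ?a = "if k < j then 1 else 0 :: nat"
    have a: "tape m (s k) (Suc k) = ?a"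
      by (simp add: cell)
    have "((write_state p (Suc (n - Suc k)), ?a), (write_state p (n - Suc k), ?a + 2, Right))
        \<in> set (write_parameter p n)"
      unfolding set_write_parameter using Suc.prems by auto
    moreover have "Suc (n - Suc k) = n - k" using Suc.prems by simp
    ultimately have "reach ?M (write_state p (n - k), tape m (s k), Suc k)
       (write_state p (n - Suc k), (tape m (s k))(Suc k := ?a + 2), Suc (Suc k))"
      using param by (intro reach_Right[OF M]) (auto simp: a simp del: tape_Suc)
    moreover have "(tape m (s k))(Suc k := ?a + 2) = tape m (s (Suc k))"
    proof -
      have "set_encode (insert 1 (column m (s k) k)) = ?a + 2"
        using cell[of k k] by (subst set_encode_insert) (auto simp: column_def s_def)
      moreover have "s k 1 = k" "(s k)(1 := Suc k) = s (Suc k)"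
        by (auto simp: s_def)
      ultimately show ?thesis using tape_Inc[of 1 m "s k"] m(2) by simp
    qed
    ultimately have "reach ?M (write_state p (n - k), tape m (s k), Suc k)
        (write_state p (n - Suc k), tape m (s (Suc k)), Suc (Suc k))"
      by (simp only:)
    with Suc.IH[OF Suc_leD[OF Suc.prems]] show ?case by (rule reach_trans)
  qed
  have "reach ?M (write_state p n, tape m (s 0), 1) (write_state p 0, tape m (s n), Suc n)"
    using writing[of n] by simp
  also have "reach ?M \<dots> (2, tape m (s n), n)"
  proof (rule reach_Left_same[OF M])
    have "tape m (s n) (Suc n) = (if n < j then 1 else 0)"
      by (simp add: cell)
    then show "((write_state p 0, tape m (s n) (Suc n)), 2, tape m (s n) (Suc n), Left) \<in> set ?M"
      using fixed by (auto simp: fixed_part_def)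
  qed
  also have "reach ?M \<dots> (3, tape m (s n), 1)"
    by (rule reach_return[OF M]) (use fixed in \<open>auto simp: fixed_part_def\<close>)
  also have "reach ?M \<dots> (?e, tape m ((\<lambda>_. 0)(0 := v)), 1)"
    by (rule compile_correct[OF M exec[folded s_def] m(1)]) (use fixed in \<open>auto simp: fixed_part_def\<close>)
  finally obtain c where c: "steps ?M (write_state p n, [2 ^ m], first_symbol w # tl w) c"
    "represents c (?e, tape m ((\<lambda>_. 0)(0 := v)), 1)"
    using rep unfolding reach_def by blast
  obtain l r where c_eq: "c = (?e, l, r)" and l: "l = [2 ^ m]"
    and r: "\<And>i. nth0 r i = tape m ((\<lambda>_. 0)(0 := v)) (1 + i)"
    using c(2) by (cases c) auto
  \<comment> \<open>The exit state lies between the compiled states and the writing states, which is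
    why the latter start at 4 + \<open>size_states p\<close>.\<close>
  have "map_of ?M (?e, a) = None" for a
  proof -
    have "((?e, a), v) \<notin> set ?M" for v
      by (auto simp: parametrised_def fixed_part_def set_row set_write_parameter write_state_def
          dest!: compile_states)
    then show ?thesis by (auto simp: map_of_eq_None_iff image_iff)
  qed
  then have halt: "tm_step ?M (?e, l, r) = None" by simp
  have "column m ((\<lambda>_. 0)(0 := v)) i = (if i < v then {0} else {})" for i
    using m(2) by (auto simp: column_def)
  then have "nth0 r i = (if i < v then 1 else 0)" for i
    using r by (simp add: set_encode_def)
  then have "count_list r 1 = v" by (rule count_strokes)
  \<comment> \<open>The marker \<open>2 ^ m\<close> differs from the stroke 1, so it does not enter
    the output.\<close>
  moreover have "count_list l 1 = 0" using m(2) by (simp add: l)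
  moreover have "steps ?M (0, [], w) (?e, l, r)"
    using start2 c(1) unfolding steps_def c_eq by (rule rtranclp_trans)
  ultimately show ?thesis
    unfolding tm_computes_def steps_def w_def
    by (intro exI[of _ ?e] exI[of _ l] exI[of _ r]) (simp only: halt, simp)
qed

section \<open>Functions computed by register programs\<close>

text \<open>
  The program works in place: argument and result are in register \<open>b\<close>, the registers below are
  preserved, and those above may contain anything.
\<close>

definition prn :: "(nat \<Rightarrow> nat) \<Rightarrow> bool" where
  "prn f \<longleftrightarrow> (\<forall>b. \<exists>p. \<forall>s. \<exists>s'. exec p s s' \<and> s' b = f (s b) \<and> (\<forall>i<b. s' i = s i))"

section \<open>Elementary register routines and the pairing function\<close>

abbreviation clear :: "nat \<Rightarrow> prog" where
  "clear r \<equiv> While r (Dec r)"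

lemma exec_clear: "exec (clear r) s (s(r := 0))"
proof (induction "s r" arbitrary: s)
  case 0
  then show ?case using While_False[of s r] by (simp add: fun_upd_idem)
next
  case (Suc k)
  then have "exec (clear r) (s(r := s r - 1)) (s(r := 0))"
    using Suc.hyps(1)[of "s(r := s r - 1)"] by simp
  then show ?case using While_True[OF _ Dec] Suc.hyps(2) by simp
qed

lemma exec_move:
  assumes "a \<noteq> b"
  shows "exec (While a (Seq (Dec a) (Inc b))) s (s(a := 0, b := s b + s a))"
proof (induction "s a" arbitrary: s)
  case 0
  then show ?case using While_False[of s a] by (simp add: fun_upd_idem)
next
  case (Suc k)
  let ?t = "s(a := s a - 1, b := Suc (s b))"
  have "exec (Seq (Dec a) (Inc b)) s ?t"
    using exec.Seq[OF exec.Dec[of a s] exec.Inc[of b]] assms by simp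
  moreover have "exec (While a (Seq (Dec a) (Inc b))) ?t (s(a := 0, b := s b + s a))"
    using Suc.hyps(1)[of ?t] Suc.hyps(2) assms by (simp add: fun_upd_twist)
  ultimately show ?case using While_True Suc.hyps(2) by (metis nat.distinct(1))
qed

lemma exec_move2:
  assumes "a \<noteq> b" "a \<noteq> c" "b \<noteq> c"
  shows "exec (While a (Seq (Dec a) (Seq (Inc b) (Inc c)))) s (s(a := 0, b := s b + s a, c := s c + s a))"
proof (induction "s a" arbitrary: s)
  case 0
  then show ?case using While_False[of s a] by (simp add: fun_upd_idem)
next
  case (Suc k)
  let ?t = "s(a := s a - 1, b := Suc (s b), c := Suc (s c))"
  have "exec (Seq (Dec a) (Seq (Inc b) (Inc c))) s ?t"
    using exec.Seq[OF exec.Dec[of a s] exec.Seq[OF exec.Inc[of b] exec.Inc[of c]]] assms by simp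
  moreover have "exec (While a (Seq (Dec a) (Seq (Inc b) (Inc c)))) ?t
      (s(a := 0, b := s b + s a, c := s c + s a))"
    using Suc.hyps(1)[of ?t] Suc.hyps(2) assms by (simp add: fun_upd_twist)
  ultimately show ?case using While_True Suc.hyps(2) by (metis nat.distinct(1))
qed

definition copy :: "nat \<Rightarrow> nat \<Rightarrow> nat \<Rightarrow> prog" where
  "copy a b c = Seq (clear b) (Seq (clear c)
     (Seq (While a (Seq (Dec a) (Seq (Inc b) (Inc c)))) (While c (Seq (Dec c) (Inc a)))))"

lemma exec_copy:
  assumes "a \<noteq> b" "a \<noteq> c" "b \<noteq> c"
  shows "exec (copy a b c) s (s(b := s a, c := 0))"
proof -
  let ?s1 = "s(b := 0, c := 0)"
  let ?s2 = "?s1(a := 0, b := ?s1 b + ?s1 a, c := ?s1 c + ?s1 a)"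
  let ?s3 = "?s2(c := 0, a := ?s2 a + ?s2 c)"
  have "exec (copy a b c) s ?s3"
    unfolding copy_def using assms
    by (intro exec.Seq[OF exec_clear] exec.Seq[OF exec_move2] exec_move) auto
  moreover have "?s3 = s(b := s a, c := 0)"
    using assms by (auto simp: fun_eq_iff)
  ultimately show ?thesis by simp
qed

text \<open>
  Pairing: \<open>triangle (a + b) + a\<close>, with \<open>triangle n = n + (n - 1) + \<dots> + 1\<close> accumulated in register \<open>t\<close>.
\<close>

definition add_triangle :: "nat \<Rightarrow> nat \<Rightarrow> nat \<Rightarrow> prog" where
  "add_triangle n t c = While n (Seq (While n (Seq (Dec n) (Seq (Inc t) (Inc c))))
     (Seq (While c (Seq (Dec c) (Inc n))) (Dec n)))"

lemma exec_add_triangle: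
  assumes "n \<noteq> t" "n \<noteq> c" "t \<noteq> c"
  shows "s c = 0 \<Longrightarrow> exec (add_triangle n t c) s (s(n := 0, t := s t + triangle (s n)))"
proof (induction "s n" arbitrary: s)
  case 0
  have n: "s(n := 0) = s" using 0 by (intro fun_upd_idem) simp
  show ?case using 0 While_False[of s n] unfolding add_triangle_def n by simp
next
  case (Suc k)
  let ?s1 = "s(n := 0, t := s t + s n, c := s c + s n)"
  let ?s2 = "?s1(c := 0, n := ?s1 n + ?s1 c)"
  let ?s3 = "?s2(n := ?s2 n - 1)"
  have body: "exec (Seq (While n (Seq (Dec n) (Seq (Inc t) (Inc c))))
     (Seq (While c (Seq (Dec c) (Inc n))) (Dec n))) s ?s3"
    using assms by (intro exec.Seq[OF exec_move2] exec.Seq[OF exec_move] exec.Dec) auto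
  have "exec (add_triangle n t c) ?s3 (?s3(n := 0, t := ?s3 t + triangle (?s3 n)))"
    by (rule Suc.hyps(1)) (use assms Suc in auto)
  moreover have "?s3(n := 0, t := ?s3 t + triangle (?s3 n)) = s(n := 0, t := s t + triangle (s n))"
    using assms Suc.prems Suc.hyps(2)[symmetric] by (auto simp: fun_eq_iff)
  ultimately show ?case
    using While_True[OF _ body] Suc.hyps(2) unfolding add_triangle_def by (metis nat.distinct(1))
qed

definition encode_pair :: "nat \<Rightarrow> nat \<Rightarrow> nat \<Rightarrow> nat \<Rightarrow> prog" where
  "encode_pair a b n c = Seq (clear n) (Seq (clear c)
     (Seq (While b (Seq (Dec b) (Inc n)))
     (Seq (While a (Seq (Dec a) (Seq (Inc b) (Inc n))))
     (Seq (add_triangle n b c) (While b (Seq (Dec b) (Inc a)))))))"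

lemma exec_encode_pair:
  assumes "distinct [a, b, n, c]"
  shows "exec (encode_pair a b n c) s (s(a := prod_encode (s a, s b), b := 0, n := 0, c := 0))"
proof -
  let ?s1 = "s(n := 0, c := 0)"
  let ?s2 = "?s1(b := 0, n := ?s1 n + ?s1 b)"
  let ?s3 = "?s2(a := 0, b := ?s2 b + ?s2 a, n := ?s2 n + ?s2 a)"
  let ?s4 = "?s3(n := 0, b := ?s3 b + triangle (?s3 n))"
  let ?s5 = "?s4(b := 0, a := ?s4 a + ?s4 b)"
  have "exec (encode_pair a b n c) s ?s5"
    unfolding encode_pair_def using assms
    by (intro exec.Seq[OF exec_clear] exec.Seq[OF exec_move2] exec.Seq[OF exec_move]
        exec.Seq[OF exec_add_triangle] exec_move) auto
  moreover have "?s5 = s(a := prod_encode (s a, s b), b := 0, n := 0, c := 0)"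
    using assms by (auto simp: fun_eq_iff prod_encode_def add.commute)
  ultimately show ?thesis by simp
qed

text \<open>Decoding becomes counting: one step along the diagonals per unit, starting from (0, 0),
  with no inversion of triangular numbers.\<close>

lemma prod_decode_Suc:
  "prod_decode (Suc n) = (case prod_decode n of (a, b) \<Rightarrow> if b = 0 then (0, Suc a) else (Suc a, b - 1))"
proof (cases "prod_decode n")
  case (Pair a b)
  then have n: "n = prod_encode (a, b)" by (metis prod_decode_inverse)
  have "Suc n = prod_encode (if b = 0 then (0, Suc a) else (Suc a, b - 1))"
    by (cases b) (auto simp: n prod_encode_def)
  then show ?thesis by (simp add: Pair)
qed

text \<open>
  One step along the diagonals. The registers \<open>f\<close> and \<open>g\<close> hold the test \<open>y = 0\<close> and the old contents of
  \<open>y\<close>; if \<open>y\<close> was 0, then only the last loop has an effect, and it moves \<open>x + 1\<close> to \<open>y\<close>.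
\<close>

definition next_pair :: "nat \<Rightarrow> nat \<Rightarrow> nat \<Rightarrow> nat \<Rightarrow> prog" where
  "next_pair x y f g = Seq (Inc x) (Seq (clear f) (Seq (clear g) (Seq (Inc f)
     (Seq (While y (Seq (Dec f) (While y (Seq (Dec y) (Inc g)))))
     (Seq (Dec g) (Seq (While g (Seq (Dec g) (Inc y)))
     (While f (Seq (Dec f) (While x (Seq (Dec x) (Inc y)))))))))))"

lemma exec_next_pair:
  assumes "distinct [x, y, f, g]"
  shows "exec (next_pair x y f g) s
    (if s y = 0 then s(x := 0, y := Suc (s x), f := 0, g := 0)
     else s(x := Suc (s x), y := s y - 1, f := 0, g := 0))"
proof -
  let ?L1 = "While y (Seq (Dec f) (While y (Seq (Dec y) (Inc g))))"
  let ?L2 = "While g (Seq (Dec g) (Inc y))"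
  let ?L3 = "While f (Seq (Dec f) (While x (Seq (Dec x) (Inc y))))"
  define s1 where "s1 = s(x := Suc (s x))"
  define s3 where "s3 = s1(f := 0, g := 0)"
  define s4 where "s4 = s3(f := Suc (s3 f))"
  have s4: "s4 x = Suc (s x)" "s4 y = s y" "s4 f = 1" "s4 g = 0"
    and other: "\<And>i. i \<notin> {x, y, f, g} \<Longrightarrow> s4 i = s i"
    using assms by (auto simp: s4_def s3_def s1_def)
  have init: "exec (next_pair x y f g) s u"
    if "exec (Seq ?L1 (Seq (Dec g) (Seq ?L2 ?L3))) s4 u" for u
  proof -
    have "exec (Inc x) s s1" "exec (clear f) s1 (s1(f := 0))" "exec (clear g) (s1(f := 0)) s3"
      "exec (Inc f) s3 s4"
      unfolding s4_def s3_def s1_def by (rule exec.Inc exec_clear)+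
    then show ?thesis
      unfolding next_pair_def by (elim exec.Seq) (rule that)
  qed
  show ?thesis
  proof (cases "s y = 0")
    case True
    define t where "t = s4(f := s4 f - 1)"
    define u where "u = t(x := 0, y := t y + t x)"
    have t: "t x = Suc (s x)" "t y = 0" "t g = 0"
      using assms s4 True by (auto simp: t_def)
    have u: "u f = 0"
      using assms s4 by (auto simp: u_def t_def)
    have "exec ?L1 s4 s4" by (rule While_False) (simp add: s4 True)
    moreover have "exec (Dec g) s4 s4" using exec.Dec[of g s4] by (simp add: s4 fun_upd_idem)
    moreover have "exec ?L2 s4 s4" by (rule While_False) (simp add: s4)
    moreover have "exec ?L3 s4 u"
    proof (rule While_True)
      have "exec (Dec f) s4 t" unfolding t_def by (rule exec.Dec)
      moreover have "exec (While x (Seq (Dec x) (Inc y))) t u"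
        unfolding u_def by (rule exec_move) (use assms in auto)
      ultimately show "exec (Seq (Dec f) (While x (Seq (Dec x) (Inc y)))) s4 u" by (rule exec.Seq)
      show "exec ?L3 u u" by (rule While_False) (rule u)
    qed (simp add: s4)
    ultimately have "exec (next_pair x y f g) s u" by (intro init exec.Seq)
    moreover have "u = s(x := 0, y := Suc (s x), f := 0, g := 0)"
    proof
      fix i
      show "u i = (s(x := 0, y := Suc (s x), f := 0, g := 0)) i"
        using assms t u other[of i] by (auto simp: u_def t_def s4)
    qed
    ultimately show ?thesis using True by simp
  next
    case False
    define t where "t = s4(f := s4 f - 1)"
    define u where "u = t(y := 0, g := t g + t y)"
    define v where "v = u(g := u g - 1)"
    define w where "w = v(g := 0, y := v y + v g)"
    have t: "t y = s y" "t g = 0"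
      using assms s4 by (auto simp: t_def)
    have v: "v y = 0" "v g = s y - 1"
      using assms t by (auto simp: v_def u_def)
    have w: "w f = 0"
      using assms s4 by (auto simp: w_def v_def u_def t_def)
    have "exec ?L1 s4 u"
    proof (rule While_True)
      have "exec (Dec f) s4 t" unfolding t_def by (rule exec.Dec)
      moreover have "exec (While y (Seq (Dec y) (Inc g))) t u"
        unfolding u_def by (rule exec_move) (use assms in auto)
      ultimately show "exec (Seq (Dec f) (While y (Seq (Dec y) (Inc g)))) s4 u" by (rule exec.Seq)
      show "exec ?L1 u u" by (rule While_False) (use assms in \<open>auto simp: u_def\<close>)
    qed (simp add: s4 False)
    moreover have "exec (Dec g) u v" unfolding v_def by (rule exec.Dec)
    moreover have "exec ?L2 v w" unfolding w_def by (rule exec_move) (use assms in auto)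
    moreover have "exec ?L3 w w" by (rule While_False) (rule w)
    ultimately have "exec (next_pair x y f g) s w" by (intro init exec.Seq)
    moreover have "w = s(x := Suc (s x), y := s y - 1, f := 0, g := 0)"
    proof
      fix i
      show "w i = (s(x := Suc (s x), y := s y - 1, f := 0, g := 0)) i"
        using assms v w other[of i] by (auto simp: w_def v_def u_def t_def s4)
    qed
    ultimately show ?thesis using False by simp
  qed
qed

definition decode_pair :: "nat \<Rightarrow> nat \<Rightarrow> nat \<Rightarrow> nat \<Rightarrow> nat \<Rightarrow> prog" where
  "decode_pair a x y f g = Seq (clear x) (Seq (clear y)
     (Seq (While a (Seq (Dec a) (next_pair x y f g)))
     (Seq (While x (Seq (Dec x) (Inc a))) (While y (Seq (Dec y) (Inc x))))))"

lemma exec_decode_loop: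
  assumes "distinct [a, x, y, f, g]"
  shows "(s x, s y) = prod_decode k \<Longrightarrow>
    \<exists>s'. exec (While a (Seq (Dec a) (next_pair x y f g))) s s' \<and> s' a = 0 \<and>
      (s' x, s' y) = prod_decode (k + s a) \<and> (\<forall>i. i \<notin> {a, x, y, f, g} \<longrightarrow> s' i = s i)"
proof (induction "s a" arbitrary: s k)
  case 0
  then show ?case using While_False[of s a] by auto
next
  case (Suc n)
  define s1 where "s1 = s(a := s a - 1)"
  define s2 where "s2 = (if s1 y = 0 then s1(x := 0, y := Suc (s1 x), f := 0, g := 0)
     else s1(x := Suc (s1 x), y := s1 y - 1, f := 0, g := 0))"
  have "exec (Dec a) s s1" unfolding s1_def by (rule exec.Dec)
  moreover have "exec (next_pair x y f g) s1 s2"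
    unfolding s2_def by (rule exec_next_pair) (use assms in simp)
  ultimately have body: "exec (Seq (Dec a) (next_pair x y f g)) s s2" by (rule exec.Seq)
  have "s1 x = s x" "s1 y = s y" using assms by (auto simp: s1_def)
  then have pair: "(s2 x, s2 y) = prod_decode (Suc k)"
    unfolding prod_decode_Suc Suc.prems[symmetric] using assms by (simp add: s2_def)
  have n: "n = s2 a" using Suc.hyps(2)[symmetric] assms by (simp add: s2_def s1_def)
  have other: "s2 i = s i" if "i \<notin> {a, x, y, f, g}" for i
    using that by (simp add: s2_def s1_def)
  obtain s' where s': "exec (While a (Seq (Dec a) (next_pair x y f g))) s2 s'" "s' a = 0"
    "(s' x, s' y) = prod_decode (Suc k + s2 a)" "\<forall>i. i \<notin> {a, x, y, f, g} \<longrightarrow> s' i = s2 i"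
    using Suc.hyps(1)[OF n pair] by blast
  have "exec (While a (Seq (Dec a) (next_pair x y f g))) s s'"
    using While_True[OF _ body s'(1)] Suc.hyps(2) by simp
  moreover have "Suc k + s2 a = k + s a" using n Suc.hyps(2) by simp
  then have "(s' x, s' y) = prod_decode (k + s a)" using s'(3) by (simp only:)
  moreover have "\<forall>i. i \<notin> {a, x, y, f, g} \<longrightarrow> s' i = s i" using s'(4) other by simp
  ultimately show ?case using s'(2) by blast
qed

lemma exec_decode_pair:
  assumes "distinct [a, x, y, f, g]"
  shows "\<exists>s'. exec (decode_pair a x y f g) s s' \<and> (s' a, s' x) = prod_decode (s a) \<and>
    (\<forall>i. i \<notin> {a, x, y, f, g} \<longrightarrow> s' i = s i)"
proof -
  define s1 where "s1 = s(x := 0, y := 0)"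
  have "(s1 x, s1 y) = prod_decode 0"
    using prod_encode_inverse[of "(0, 0)"] by (simp add: s1_def prod_encode_def)
  from exec_decode_loop[OF assms this] obtain t where
    t: "exec (While a (Seq (Dec a) (next_pair x y f g))) s1 t" "t a = 0"
    "(t x, t y) = prod_decode (0 + s1 a)" "\<forall>i. i \<notin> {a, x, y, f, g} \<longrightarrow> t i = s1 i"
    by blast
  have s1: "s1 a = s a" "\<forall>i. i \<notin> {a, x, y, f, g} \<longrightarrow> s1 i = s i"
    using assms by (auto simp: s1_def)
  have clear: "exec (clear y) (s(x := 0)) s1"
    unfolding s1_def by (rule exec_clear)
  let ?t1 = "t(x := 0, a := t a + t x)"
  let ?t2 = "?t1(y := 0, x := ?t1 x + ?t1 y)"
  have m1: "exec (While x (Seq (Dec x) (Inc a))) t ?t1"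
    by (rule exec_move) (use assms in auto)
  have m2: "exec (While y (Seq (Dec y) (Inc x))) ?t1 ?t2"
    by (rule exec_move) (use assms in auto)
  have "exec (decode_pair a x y f g) s ?t2"
    unfolding decode_pair_def
    by (rule exec.Seq[OF exec_clear exec.Seq[OF clear exec.Seq[OF t(1) exec.Seq[OF m1 m2]]]])
  moreover have "(?t2 a, ?t2 x) = (t x, t y)"
    using t(2) assms by auto
  then have "(?t2 a, ?t2 x) = prod_decode (s a)"
    using t(3) s1(1) by simp
  moreover have "\<forall>i. i \<notin> {a, x, y, f, g} \<longrightarrow> ?t2 i = s i"
    using t(4) s1(2) by simp
  ultimately show ?thesis by (intro exI[of _ ?t2] conjI)
qed

section \<open>Closure properties of the functions computed in place\<close>

lemma prnI:
  assumes "\<And>b. \<exists>p. \<forall>s. \<exists>s'. exec p s s' \<and> s' b = f (s b) \<and> (\<forall>i<b. s' i = s i)"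
  shows "prn f"
  using assms unfolding prn_def by blast

lemma prnE:
  assumes "prn f"
  obtains p where "\<And>s. \<exists>s'. exec p s s' \<and> s' b = f (s b) \<and> (\<forall>i<b. s' i = s i)"
  using assms unfolding prn_def by blast

lemma prn_Suc: "prn Suc"
proof (rule prnI)
  fix b
  show "\<exists>p. \<forall>s. \<exists>s'. exec p s s' \<and> s' b = Suc (s b) \<and> (\<forall>i<b. s' i = s i)"
    by (intro exI[of _ "Inc b"] allI exI conjI, rule exec.Inc) auto
qed

lemma prn_zero: "prn (\<lambda>_. 0)"
proof (rule prnI)
  fix b
  show "\<exists>p. \<forall>s. \<exists>s'. exec p s s' \<and> s' b = 0 \<and> (\<forall>i<b. s' i = s i)"
    by (intro exI[of _ "clear b"] allI exI conjI, rule exec_clear) auto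
qed

lemma prn_comp:
  assumes "prn f" "prn g"
  shows "prn (\<lambda>x. f (g x))"
proof (rule prnI)
  fix b
  obtain p where p: "\<And>s. \<exists>s'. exec p s s' \<and> s' b = f (s b) \<and> (\<forall>i<b. s' i = s i)"
    by (rule prnE[OF assms(1), where b = "b"]) blast
  obtain q where q: "\<And>s. \<exists>s'. exec q s s' \<and> s' b = g (s b) \<and> (\<forall>i<b. s' i = s i)"
    by (rule prnE[OF assms(2), where b = "b"]) blast
  have "\<exists>s'. exec (Seq q p) s s' \<and> s' b = f (g (s b)) \<and> (\<forall>i<b. s' i = s i)" for s
  proof -
    from q[of s] obtain t where t: "exec q s t" "t b = g (s b)" "\<forall>i<b. t i = s i" by blast
    from p[of t] obtain u where "exec p t u" "u b = f (t b)" "\<forall>i<b. u i = t i" by blast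
    with t show ?thesis by (intro exI[of _ u]) (auto intro: exec.Seq)
  qed
  then show "\<exists>p. \<forall>s. \<exists>s'. exec p s s' \<and> s' b = f (g (s b)) \<and> (\<forall>i<b. s' i = s i)" by blast
qed

lemma exec_decode_base:
  "\<exists>t. exec (decode_pair b (b+1) (b+2) (b+3) (b+4)) s t \<and> t b = fst (prod_decode (s b)) \<and>
    t (b+1) = snd (prod_decode (s b)) \<and> (\<forall>i<b. t i = s i)"
proof -
  have "distinct [b, b+1, b+2, b+3, b+4]" by simp
  from exec_decode_pair[OF this, of s] obtain t where
    t: "exec (decode_pair b (b+1) (b+2) (b+3) (b+4)) s t" "(t b, t (b+1)) = prod_decode (s b)"
    "\<forall>i. i \<notin> {b, b+1, b+2, b+3, b+4} \<longrightarrow> t i = s i"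
    by blast
  have "\<forall>i<b. t i = s i" using t(3) by simp
  with t(1) show ?thesis by (intro exI[of _ t]) (simp flip: t(2))
qed

lemma prn_fst: "prn (\<lambda>x. fst (prod_decode x))"
proof (rule prnI)
  fix b
  show "\<exists>p. \<forall>s. \<exists>s'. exec p s s' \<and> s' b = fst (prod_decode (s b)) \<and> (\<forall>i<b. s' i = s i)"
    using exec_decode_base by blast
qed

lemma prn_snd: "prn (\<lambda>x. snd (prod_decode x))"
proof (rule prnI)
  fix b
  let ?p = "Seq (decode_pair b (b+1) (b+2) (b+3) (b+4))
    (Seq (clear b) (While (b+1) (Seq (Dec (b+1)) (Inc b))))"
  have "\<exists>s'. exec ?p s s' \<and> s' b = snd (prod_decode (s b)) \<and> (\<forall>i<b. s' i = s i)" for s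
  proof -
    obtain t where t: "exec (decode_pair b (b+1) (b+2) (b+3) (b+4)) s t"
      "t b = fst (prod_decode (s b))" "t (b+1) = snd (prod_decode (s b))" "\<forall>i<b. t i = s i"
      using exec_decode_base by blast
    let ?t1 = "t(b := 0)"
    let ?t2 = "?t1(b+1 := 0, b := ?t1 b + ?t1 (b+1))"
    have "exec ?p s ?t2"
      by (intro exec.Seq[OF t(1)] exec.Seq[OF exec_clear] exec_move) simp
    moreover have "?t2 b = snd (prod_decode (s b))" "\<forall>i<b. ?t2 i = s i"
      using t(3,4) by simp_all
    ultimately show ?thesis by blast
  qed
  then show "\<exists>p. \<forall>s. \<exists>s'. exec p s s' \<and> s' b = snd (prod_decode (s b)) \<and> (\<forall>i<b. s' i = s i)" by blast
qed

text \<open>The argument survives in register \<open>b\<close> while \<open>f\<close> works from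
  \<open>b + 1\<close> on and \<open>g\<close> from \<open>b + 2\<close> on, since neither touches
  lower registers.\<close>

lemma prn_pair:
  assumes "prn f" "prn g"
  shows "prn (\<lambda>x. prod_encode (f x, g x))"
proof (rule prnI)
  fix b
  obtain p where p: "\<And>s. \<exists>s'. exec p s s' \<and> s' (b+1) = f (s (b+1)) \<and> (\<forall>i<b+1. s' i = s i)"
    by (rule prnE[OF assms(1), where b = "b+1"]) blast
  obtain q where q: "\<And>s. \<exists>s'. exec q s s' \<and> s' (b+2) = g (s (b+2)) \<and> (\<forall>i<b+2. s' i = s i)"
    by (rule prnE[OF assms(2), where b = "b+2"]) blast
  let ?p = "Seq (copy b (b+1) (b+2)) (Seq p (Seq (copy b (b+2) (b+3)) (Seq q
     (Seq (encode_pair (b+1) (b+2) (b+3) (b+4)) (Seq (clear b) (While (b+1) (Seq (Dec (b+1)) (Inc b))))))))"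
  have "\<exists>s'. exec ?p s s' \<and> s' b = prod_encode (f (s b), g (s b)) \<and> (\<forall>i<b. s' i = s i)" for s
  proof -
    let ?s1 = "s(b+1 := s b, b+2 := 0)"
    obtain s2 where s2: "exec p ?s1 s2" "s2 (b+1) = f (s b)" "\<forall>i<b+1. s2 i = s i"
      using p[of ?s1] by auto
    let ?s3 = "s2(b+2 := s2 b, b+3 := 0)"
    obtain s4 where s4: "exec q ?s3 s4" "s4 (b+2) = g (s b)" "\<forall>i<b+2. s4 i = ?s3 i"
      using q[of ?s3] s2(3) by auto
    let ?s5 = "s4(b+1 := prod_encode (s4 (b+1), s4 (b+2)), b+2 := 0, b+3 := 0, b+4 := 0)"
    let ?s6 = "?s5(b := 0)"
    let ?s7 = "?s6(b+1 := 0, b := ?s6 b + ?s6 (b+1))"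
    have "exec ?p s ?s7"
      by (intro exec.Seq[OF exec_copy] exec.Seq[OF s2(1)] exec.Seq[OF s4(1)]
          exec.Seq[OF exec_encode_pair] exec.Seq[OF exec_clear] exec_move) auto
    moreover have "s4 (b+1) = f (s b)" using s2(2) s4(3) by simp
    then have "?s7 b = prod_encode (f (s b), g (s b))" using s4(2) by simp
    moreover have "\<forall>i<b. ?s7 i = s i" using s4(3) s2(3) by simp
    ultimately show ?thesis by blast
  qed
  then show "\<exists>p. \<forall>s. \<exists>s'. exec p s s' \<and> s' b = prod_encode (f (s b), g (s b)) \<and> (\<forall>i<b. s' i = s i)"
    by blast
qed

text \<open>Iteration is the only recursion scheme taken from the programs; together with pairing it
  gives primitive recursion in \<open>pr_rec_nat\<close>.\<close>

lemma prn_iterate: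
  assumes "prn f"
  shows "prn (\<lambda>x. (f ^^ fst (prod_decode x)) (snd (prod_decode x)))"
proof (rule prnI)
  fix b
  obtain p where p: "\<And>s. \<exists>s'. exec p s s' \<and> s' (b+1) = f (s (b+1)) \<and> (\<forall>i<b+1. s' i = s i)"
    by (rule prnE[OF assms, where b = "b+1"]) blast
  let ?L = "While b (Seq (Dec b) p)"
  have loop: "\<exists>s'. exec ?L s s' \<and> s' (b+1) = (f ^^ s b) (s (b+1)) \<and> (\<forall>i<b. s' i = s i)" for s
  proof (induction "s b" arbitrary: s)
    case 0
    then show ?case using While_False[of s b] by auto
  next
    case (Suc n)
    let ?s1 = "s(b := s b - 1)"
    obtain t where t: "exec p ?s1 t" "t (b+1) = f (s (b+1))" "\<forall>i<b+1. t i = ?s1 i"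
      using p[of ?s1] by auto
    have "n = t b" using t(3) Suc.hyps(2) by auto
    from Suc.hyps(1)[of t, OF this] obtain u where
      u: "exec ?L t u" "u (b+1) = (f ^^ t b) (t (b+1))" "\<forall>i<b. u i = t i" by blast
    have "exec ?L s u"
      by (rule While_True[OF _ exec.Seq[OF exec.Dec t(1)] u(1)]) (use Suc.hyps(2) in simp)
    moreover have "u (b+1) = (f ^^ s b) (s (b+1))"
      using u(2) t(2) \<open>n = t b\<close> Suc.hyps(2)[symmetric] by (simp flip: funpow_swap1)
    ultimately show ?case using u(3) t(3) by (intro exI[of _ u]) auto
  qed
  let ?p = "Seq (decode_pair b (b+1) (b+2) (b+3) (b+4)) (Seq ?L
     (Seq (clear b) (While (b+1) (Seq (Dec (b+1)) (Inc b)))))"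
  have "\<exists>s'. exec ?p s s' \<and> s' b = (f ^^ fst (prod_decode (s b))) (snd (prod_decode (s b))) \<and>
      (\<forall>i<b. s' i = s i)" for s
  proof -
    obtain t where t: "exec (decode_pair b (b+1) (b+2) (b+3) (b+4)) s t"
      "t b = fst (prod_decode (s b))" "t (b+1) = snd (prod_decode (s b))" "\<forall>i<b. t i = s i"
      using exec_decode_base by blast
    obtain u where u: "exec ?L t u" "u (b+1) = (f ^^ t b) (t (b+1))" "\<forall>i<b. u i = t i"
      using loop by blast
    let ?u1 = "u(b := 0)"
    let ?u2 = "?u1(b+1 := 0, b := ?u1 b + ?u1 (b+1))"
    have "exec ?p s ?u2"
      by (intro exec.Seq[OF t(1)] exec.Seq[OF u(1)] exec.Seq[OF exec_clear] exec_move) simp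
    moreover have "?u2 b = (f ^^ fst (prod_decode (s b))) (snd (prod_decode (s b)))"
      "\<forall>i<b. ?u2 i = s i"
      using u(2,3) t(2-4) by simp_all
    ultimately show ?thesis by blast
  qed
  then show "\<exists>p. \<forall>s. \<exists>s'. exec p s s' \<and>
      s' b = (f ^^ fst (prod_decode (s b))) (snd (prod_decode (s b))) \<and> (\<forall>i<b. s' i = s i)"
    by blast
qed

text \<open>Leftovers in other registers would alter the tape symbols and spoil the final count of
  strokes. For lack of an empty program, the base case increments and decrements register 0.\<close>

lemma exec_clear_all:
  "\<exists>p. \<forall>s. exec p s (\<lambda>i. if 0 < i \<and> i < m then 0 else s i)"
proof (induction m)
  case 0
  have "exec (Seq (Inc 0) (Dec 0)) s s" for s
    using exec.Seq[OF exec.Inc[of 0 s] exec.Dec[of 0]] by simp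
  then show ?case by auto
next
  case (Suc m)
  then obtain p where p: "\<And>s. exec p s (\<lambda>i. if 0 < i \<and> i < m then 0 else s i)" by blast
  show ?case
  proof (cases "m = 0")
    case True
    then have "(\<lambda>i. if 0 < i \<and> i < Suc m then 0 else s i) = (\<lambda>i. if 0 < i \<and> i < m then 0 else s i)"
      for s :: "nat \<Rightarrow> nat" by (auto simp: fun_eq_iff)
    then show ?thesis using p by auto
  next
    case False
    then have eq: "(\<lambda>i. if 0 < i \<and> i < m then 0 else s i)(m := 0) = (\<lambda>i. if 0 < i \<and> i < Suc m then 0 else s i)"
      for s :: "nat \<Rightarrow> nat" by (auto simp: fun_eq_iff)
    have "exec (Seq p (clear m)) s (\<lambda>i. if 0 < i \<and> i < Suc m then 0 else s i)" for s
      using exec.Seq[OF p exec_clear[of m], of s] unfolding eq .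
    then show ?thesis by blast
  qed
qed

lemma exec_outside: "exec p s s' \<Longrightarrow> bound p \<le> i \<Longrightarrow> s' i = s i"
  by (induction rule: exec.induct) auto

lemma prn_machine:
  assumes "prn g"
  obtains m p where "\<And>n j. tm_computes (parametrised m p n) j (g (prod_encode (n, j)))"
proof -
  obtain p where p: "\<And>s. \<exists>s'. exec p s s' \<and> s' 1 = g (s 1) \<and> (\<forall>i<1. s' i = s i)"
    by (rule prnE[OF assms, where b = "1"]) blast
  \<comment> \<open>Register 1 holds the parameter and register 0 the input. Pairing moves both into
    register 1 and empties register 0, which can then receive the result.\<close>
  let ?q = "Seq (encode_pair 1 0 2 3) (Seq p (While 1 (Seq (Dec 1) (Inc 0))))"
  obtain c where c: "\<And>s. exec c s (\<lambda>i. if 0 < i \<and> i < bound ?q then 0 else s i)"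
    using exec_clear_all by blast
  have "tm_computes (parametrised (max 2 (bound (Seq ?q c))) (Seq ?q c) n) j (g (prod_encode (n, j)))" for n j
  proof (rule parametrised_computes)
    let ?s = "(\<lambda>_. 0)(0 := j, 1 := n) :: nat \<Rightarrow> nat"
    let ?s1 = "?s(1 := prod_encode (?s 1, ?s 0), 0 := 0, 2 := 0, 3 := 0)"
    obtain t where t: "exec p ?s1 t" "t 1 = g (prod_encode (n, j))" "t 0 = 0"
      using p[of ?s1] by auto
    let ?u = "t(1 := 0, 0 := t 0 + t 1)"
    have u: "exec ?q ?s ?u"
      by (intro exec.Seq[OF exec_encode_pair] exec.Seq[OF t(1)] exec_move) auto
    have "(\<lambda>i. if 0 < i \<and> i < bound ?q then 0 else ?u i) = (\<lambda>_. 0)(0 := g (prod_encode (n, j)))"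
    proof
      fix i
      have "?u i = ?s i" if "bound ?q \<le> i" using exec_outside[OF u that] .
      moreover have "1 < bound ?q" by simp
      ultimately show "(if 0 < i \<and> i < bound ?q then 0 else ?u i) = ((\<lambda>_. 0)(0 := g (prod_encode (n, j)))) i"
        using t(2,3) by (cases "i < bound ?q") (auto simp: not_less)
    qed
    then show "exec (Seq ?q c) ?s ((\<lambda>_. 0)(0 := g (prod_encode (n, j))))"
      using exec.Seq[OF u c] by simp
  qed auto
  then show ?thesis using that by blast
qed

section \<open>Computable functions on encoded data\<close>

text \<open>Injectivity is enough: a function on the type constrains its numerical counterpart only
  on codes. The instances follow the codings used in the statement of the problem.\<close>

class encodable =
  fixes encode :: "'a \<Rightarrow> nat"
  assumes encode_eq_iff: "encode x = encode y \<longleftrightarrow> x = y"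

instantiation nat :: encodable
begin
definition encode_nat :: "nat \<Rightarrow> nat" where [simp]: "encode_nat n = n"
instance by standard simp
end

instantiation bool :: encodable
begin
definition encode_bool :: "bool \<Rightarrow> nat" where "encode_bool b = (if b then 1 else 0)"
instance by standard (auto simp: encode_bool_def)
end

instantiation int :: encodable
begin
definition encode_int :: "int \<Rightarrow> nat" where "encode_int = int_encode"
instance by standard (simp add: encode_int_def inj_eq[OF inj_int_encode])
end

instantiation direction :: encodable
begin
definition encode_direction :: "direction \<Rightarrow> nat" where "encode_direction = direction_code"
instance
proof
  fix x y :: direction
  show "encode x = encode y \<longleftrightarrow> x = y"
    by (cases x; cases y) (auto simp: encode_direction_def)
qed
end

instantiation prod :: (encodable, encodable) encodable
begin
definition encode_prod :: "'a \<times> 'b \<Rightarrow> nat" where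
  "encode_prod p = prod_encode (encode (fst p), encode (snd p))"
instance by standard (auto simp: encode_prod_def encode_eq_iff prod_eq_iff)
end

instantiation list :: (encodable) encodable
begin
definition encode_list :: "'a list \<Rightarrow> nat" where "encode_list l = list_encode (map encode l)"
instance
proof
  fix x y :: "'a list"
  have "inj (encode :: 'a \<Rightarrow> nat)" by (auto simp: inj_def encode_eq_iff)
  then show "encode x = encode y \<longleftrightarrow> x = y"
    by (simp add: encode_list_def inj_map_eq_map inj_eq[OF inj_list_encode])
qed
end

instantiation option :: (encodable) encodable
begin
definition encode_option :: "'a option \<Rightarrow> nat" where
  "encode_option x = (case x of None \<Rightarrow> 0 | Some a \<Rightarrow> Suc (encode a))"
instance by standard (auto simp: encode_option_def encode_eq_iff split: option.split)
end

text \<open>Most rules collected below are phrased for functions of one context variable, with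
  further arguments paired to it, so that repeated introduction follows the syntax of a
  term.\<close>

definition pr :: "('a::encodable \<Rightarrow> 'b::encodable) \<Rightarrow> bool" where
  "pr f \<longleftrightarrow> (\<exists>g. prn g \<and> (\<forall>x. encode (f x) = g (encode x)))"

named_theorems pr

lemma prn_id: "prn (\<lambda>x. x)"
  using prn_pair[OF prn_fst prn_snd] by simp

lemma prn_const: "prn (\<lambda>_. c)"
proof (induction c)
  case 0
  show ?case by (rule prn_zero)
next
  case (Suc c)
  show ?case using prn_comp[OF prn_Suc Suc] .
qed

lemma pr_nat_iff: "pr (f :: nat \<Rightarrow> nat) \<longleftrightarrow> prn f"
  by (auto simp: pr_def fun_eq_iff[symmetric] ext)

lemma prI: "pr (g :: nat \<Rightarrow> nat) \<Longrightarrow> (\<And>x. encode (f x) = g (encode x)) \<Longrightarrow> pr f"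
  unfolding pr_nat_iff by (auto simp: pr_def)

lemma pr_const [pr]: "pr (\<lambda>_. c)"
  using prn_const by (auto simp: pr_def)

lemma pr_id [pr]: "pr (\<lambda>x. x)"
  using prn_id by (auto simp: pr_def)

lemma pr_comp:
  assumes "pr f" "pr g"
  shows "pr (\<lambda>x. f (g x))"
proof -
  from assms obtain f' g' where "prn f'" "\<And>x. encode (f x) = f' (encode x)"
    "prn g'" "\<And>x. encode (g x) = g' (encode x)"
    by (auto simp: pr_def)
  then show ?thesis
    unfolding pr_def by (intro exI[of _ "\<lambda>x. f' (g' x)"]) (simp add: prn_comp)
qed

lemma pr_Pair [pr]:
  assumes "pr f" "pr g"
  shows "pr (\<lambda>x. (f x, g x))"
proof -
  from assms obtain f' g' where "prn f'" "\<And>x. encode (f x) = f' (encode x)"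
    "prn g'" "\<And>x. encode (g x) = g' (encode x)"
    by (auto simp: pr_def)
  then show ?thesis
    unfolding pr_def
    by (intro exI[of _ "\<lambda>x. prod_encode (f' x, g' x)"]) (simp add: prn_pair encode_prod_def)
qed

lemma pr_fst [pr]: "pr f \<Longrightarrow> pr (\<lambda>x. fst (f x))"
  by (rule pr_comp[of fst]) (auto simp: pr_def encode_prod_def intro!: exI[of _ "\<lambda>x. fst (prod_decode x)"] prn_fst)

lemma pr_snd [pr]: "pr f \<Longrightarrow> pr (\<lambda>x. snd (f x))"
  by (rule pr_comp[of snd]) (auto simp: pr_def encode_prod_def intro!: exI[of _ "\<lambda>x. snd (prod_decode x)"] prn_snd)

lemma pr_apply2:
  assumes "pr (\<lambda>p. h (fst p) (snd p))" "pr f" "pr g"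
  shows "pr (\<lambda>x. h (f x) (g x))"
  using pr_comp[OF assms(1) pr_Pair[OF assms(2,3)]] by simp

lemma pr_apply3:
  assumes "pr (\<lambda>p. h (fst p) (fst (snd p)) (snd (snd p)))" "pr f" "pr g" "pr k"
  shows "pr (\<lambda>x. h (f x) (g x) (k x))"
  using pr_comp[OF assms(1) pr_Pair[OF assms(2) pr_Pair[OF assms(3,4)]]] by simp

lemma pr_Suc [pr]: "pr f \<Longrightarrow> pr (\<lambda>x. Suc (f x))"
  by (rule pr_comp[of Suc]) (auto simp: pr_nat_iff prn_Suc)

lemma pr_encode [pr]: "pr f \<Longrightarrow> pr (\<lambda>x. encode (f x))"
  by (rule pr_comp[of encode]) (auto simp: pr_def intro!: exI[of _ "\<lambda>x. x"] prn_id)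

lemma pr_prod_decode [pr]: "pr f \<Longrightarrow> pr (\<lambda>x. prod_decode (f x))"
  by (rule pr_comp[of prod_decode]) (auto intro!: prI[OF pr_id] simp: encode_prod_def)

lemma pr_prod_encode [pr]: "pr f \<Longrightarrow> pr (\<lambda>x. prod_encode (f x))"
  by (rule pr_comp[of prod_encode]) (auto intro!: prI[OF pr_id] simp: encode_prod_def)

lemma pr_list_decode [pr]: "pr f \<Longrightarrow> pr (\<lambda>x. list_decode (f x))"
  by (rule pr_comp[of list_decode]) (auto intro!: prI[OF pr_id] simp: encode_list_def map_idI)

lemma pr_int_decode [pr]: "pr f \<Longrightarrow> pr (\<lambda>x. int_decode (f x))"
  by (rule pr_comp[of int_decode]) (auto intro!: prI[OF pr_id] simp: encode_int_def)

lemma pr_case_prod [pr]: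
  "pr (\<lambda>x. h x (fst (f x)) (snd (f x))) \<Longrightarrow> pr (\<lambda>x. case f x of (a, b) \<Rightarrow> h x a b)"
  by (simp add: case_prod_beta')

subsection \<open>Natural numbers and Booleans\<close>

lemma pr_funpow_fst_snd:
  fixes f :: "'a::encodable \<Rightarrow> 'a"
  assumes "pr f"
  shows "pr (\<lambda>p. (f ^^ fst p) (snd p))"
proof -
  from assms obtain g where g: "prn g" "\<And>x. encode (f x) = g (encode x)"
    by (auto simp: pr_def)
  have "encode ((f ^^ n) x) = (g ^^ n) (encode x)" for n x
    by (induction n) (simp_all add: g(2))
  then show ?thesis
    unfolding pr_def using prn_iterate[OF g(1)]
    by (intro exI[of _ "\<lambda>x. (g ^^ fst (prod_decode x)) (snd (prod_decode x))"])
      (simp add: encode_prod_def \<open>\<And>x n. encode ((f ^^ n) x) = (g ^^ n) (encode x)\<close>)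
qed

lemma pr_funpow:
  fixes f :: "'a::encodable \<Rightarrow> 'a"
  assumes "pr f" "pr n" "pr a"
  shows "pr (\<lambda>x. (f ^^ n x) (a x))"
  using pr_comp[OF pr_funpow_fst_snd[OF assms(1)] pr_Pair[OF assms(2,3)]] by simp

text \<open>The iterated state is the triple of context, counter and current value.\<close>

lemma pr_rec_nat [pr]:
  assumes a: "pr a" and h: "pr (\<lambda>p. h (fst p) (fst (snd p)) (snd (snd p)))" and k: "pr k"
  shows "pr (\<lambda>x. rec_nat (a x) (h x) (k x))"
proof -
  define step where "step p = (fst p, Suc (fst (snd p)), h (fst p) (fst (snd p)) (snd (snd p)))" for p
  have step: "pr step" unfolding step_def by (intro pr h)
  have iter: "(step ^^ n) (x, 0, a x) = (x, n, rec_nat (a x) (h x) n)" for n x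
    by (induction n) (simp_all add: step_def)
  have "pr (\<lambda>x. snd (snd ((step ^^ k x) (x, 0, a x))))"
    by (intro pr pr_funpow step a k)
  then show ?thesis by (simp add: iter)
qed

lemma pr_if [pr]:
  assumes "pr c" "pr f" "pr g"
  shows "pr (\<lambda>x. if c x then f x else g x)"
proof -
  have "pr (\<lambda>x. rec_nat (g x) (\<lambda>_ _. f x) (encode (c x)))"
    by (intro pr pr_comp[OF assms(2)] assms)
  moreover have "(\<lambda>x. rec_nat (g x) (\<lambda>_ _. f x) (encode (c x))) = (\<lambda>x. if c x then f x else g x)"
    by (auto simp: encode_bool_def)
  ultimately show ?thesis by simp
qed

lemma pr_conj [pr]:
  assumes "pr P" "pr Q"
  shows "pr (\<lambda>x. P x \<and> Q x)"
proof -
  have "pr (\<lambda>x. if P x then Q x else False)" by (intro pr assms)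
  moreover have "(\<lambda>x. if P x then Q x else False) = (\<lambda>x. P x \<and> Q x)" by auto
  ultimately show ?thesis by simp
qed

lemma pr_not [pr]:
  assumes "pr P"
  shows "pr (\<lambda>x. \<not> P x)"
proof -
  have "pr (\<lambda>x. if P x then False else True)" by (intro pr assms)
  moreover have "(\<lambda>x. if P x then False else True) = (\<lambda>x. \<not> P x)" by auto
  ultimately show ?thesis by simp
qed

lemma pr_disj [pr]:
  assumes "pr P" "pr Q"
  shows "pr (\<lambda>x. P x \<or> Q x)"
proof -
  have "pr (\<lambda>x. \<not> (\<not> P x \<and> \<not> Q x))" by (intro pr assms)
  then show ?thesis by simp
qed

lemma pr_imp [pr]: "pr P \<Longrightarrow> pr Q \<Longrightarrow> pr (\<lambda>x. P x \<longrightarrow> Q x)"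
  unfolding imp_conv_disj by (intro pr_disj pr_not)

lemma pr_add [pr]:
  assumes "pr f" "pr g"
  shows "pr (\<lambda>x. f x + g x :: nat)"
proof -
  have "rec_nat m (\<lambda>_ r. Suc r) n = m + n" for m n :: nat
    by (induction n) simp_all
  moreover have "pr (\<lambda>x. rec_nat (f x) (\<lambda>_ r. Suc r) (g x))"
    by (intro pr assms)
  ultimately show ?thesis by simp
qed

lemma pr_diff [pr]:
  assumes "pr f" "pr g"
  shows "pr (\<lambda>x. f x - g x :: nat)"
proof -
  have 1: "rec_nat 0 (\<lambda>n _. n) m = m - 1" for m :: nat
    by (cases m) simp_all
  have 2: "rec_nat m (\<lambda>_ r. rec_nat 0 (\<lambda>n _. n) r) n = m - n" for m n :: nat
    by (induction n) (simp_all add: 1)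
  have "pr (\<lambda>x. rec_nat (f x) (\<lambda>_ r. rec_nat 0 (\<lambda>n _. n) r) (g x))"
    by (intro pr assms)
  then show ?thesis by (simp only: 2)
qed

lemma pr_eq [pr]:
  assumes "pr f" "pr g"
  shows "pr (\<lambda>x. f x = g x)"
proof -
  let ?d = "\<lambda>x. (encode (f x) - encode (g x)) + (encode (g x) - encode (f x))"
  have "pr (\<lambda>x. rec_nat True (\<lambda>_ _. False) (?d x))"
    by (intro pr assms)
  moreover have "rec_nat True (\<lambda>_ _. False) n \<longleftrightarrow> n = 0" for n :: nat
    by (cases n) simp_all
  moreover have "?d x = 0 \<longleftrightarrow> f x = g x" for x
    unfolding encode_eq_iff[of "f x" "g x", symmetric] by auto
  ultimately show ?thesis by simp
qed

lemma pr_le [pr]: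
  assumes "pr f" "pr g"
  shows "pr (\<lambda>x. f x \<le> (g x :: nat))"
proof -
  have "pr (\<lambda>x. f x - g x = 0)" by (intro pr assms)
  then show ?thesis by simp
qed

lemma pr_even [pr]:
  assumes "pr f"
  shows "pr (\<lambda>x. even (f x :: nat))"
proof -
  have "rec_nat True (\<lambda>_ b. \<not> b) n \<longleftrightarrow> even n" for n :: nat
    by (induction n) simp_all
  moreover have "pr (\<lambda>x. rec_nat True (\<lambda>_ b. \<not> b) (f x))"
    by (intro pr assms)
  ultimately show ?thesis by simp
qed

lemma pr_half [pr]:
  assumes "pr f"
  shows "pr (\<lambda>x. f x div 2 :: nat)"
proof -
  have "rec_nat 0 (\<lambda>n r. if even n then r else Suc r) n = n div 2" for n :: nat
    by (induction n) (auto elim!: evenE oddE)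
  moreover have "pr (\<lambda>x. rec_nat (0::nat) (\<lambda>n r. if even n then r else Suc r) (f x))"
    by (intro pr assms)
  ultimately show ?thesis by simp
qed

lemma pr_set_decode [pr]:
  assumes "pr f" "pr g"
  shows "pr (\<lambda>x. f x \<in> set_decode (g x))"
proof -
  have "((\<lambda>n. n div 2) ^^ k) c = c div 2 ^ k" for c k :: nat
    by (induction k) (simp_all only: funpow.simps o_apply power_Suc2 div_mult2_eq, simp_all)
  moreover have "pr (\<lambda>x. \<not> even (((\<lambda>n. n div 2) ^^ f x) (g x)))"
    by (intro pr pr_funpow assms)
  ultimately show ?thesis by (simp add: set_decode_def)
qed

subsection \<open>Integers\<close>

text \<open>From its code an integer is recovered as a difference of two naturals: even codes
  \<open>2 * n\<close> stand for \<open>n\<close>, odd codes \<open>2 * n + 1\<close> for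
  \<open>- n - 1\<close>. Differences are added componentwise and coded again.\<close>

lemma pr_int_add [pr]:
  assumes "pr f" "pr g"
  shows "pr (\<lambda>x. f x + g x :: int)"
proof -
  define up where "up n = (if even n then n div 2 else 0)" for n :: nat
  define down where "down n = (if even n then 0 else Suc (n div 2))" for n :: nat
  define diff where "diff a b = (if b \<le> a then (a - b) + (a - b) else (b - a) + (b - a) - 1)" for a b :: nat
  have up_down: "i = int (up (encode i)) - int (down (encode i))" for i :: int
    by (auto simp: up_def down_def encode_int_def int_encode_def sum_encode_def)
  have diff: "encode (int a - int b) = diff a b" for a b
    by (auto simp: diff_def encode_int_def int_encode_def sum_encode_def nat_diff_distrib)
  have "i + j = int (up (encode i) + up (encode j)) - int (down (encode i) + down (encode j))" for i j :: int
    using up_down[of i] up_down[of j] by linarith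
  then have sum: "encode (i + j) = diff (up (encode i) + up (encode j)) (down (encode i) + down (encode j))" for i j :: int
    unfolding diff[symmetric] by (rule arg_cong)
  have "pr (\<lambda>n. diff (up (fst (prod_decode n)) + up (snd (prod_decode n)))
      (down (fst (prod_decode n)) + down (snd (prod_decode n))))"
    unfolding diff_def up_def down_def by (intro pr)
  then have "pr (\<lambda>p. fst p + snd p :: int)"
    by (rule prI) (simp only: encode_prod_def prod_encode_inverse fst_conv snd_conv sum)
  then show ?thesis using assms by (rule pr_apply2)
qed

subsection \<open>Options and lists\<close>

lemma pr_Some [pr]: "pr f \<Longrightarrow> pr (\<lambda>x. Some (f x))"
  by (rule pr_comp[of Some]) (auto intro!: prI[OF pr_Suc[OF pr_id]] simp: encode_option_def)

text \<open>The value \<open>the None\<close> is unspecified but fixed, so its code can serve as a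
  constant. The same device handles \<open>hd []\<close>.\<close>

lemma pr_the [pr]: "pr f \<Longrightarrow> pr (\<lambda>x. the (f x))"
proof (rule pr_comp[of the])
  have "pr (rec_nat (encode (the (None :: 'b option))) (\<lambda>n _. n))"
    by (intro pr)
  then show "pr (the :: 'b option \<Rightarrow> 'b)"
    by (rule prI) (simp add: encode_option_def split: option.split)
qed

lemma pr_case_option [pr]:
  assumes "pr f" "pr a" "pr (\<lambda>x. h x (the (f x)))"
  shows "pr (\<lambda>x. case f x of None \<Rightarrow> a x | Some y \<Rightarrow> h x y)"
proof -
  have "pr (\<lambda>x. if f x = None then a x else h x (the (f x)))"
    by (intro pr assms)
  moreover have "(\<lambda>x. if f x = None then a x else h x (the (f x))) =
      (\<lambda>x. case f x of None \<Rightarrow> a x | Some y \<Rightarrow> h x y)"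
    by (auto split: option.split)
  ultimately show ?thesis by simp
qed

lemma pr_map_option [pr]:
  assumes "pr f" "pr (\<lambda>x. h x (the (f x)))"
  shows "pr (\<lambda>x. map_option (h x) (f x))"
  unfolding map_option_case by (intro pr assms)

lemma pr_Cons [pr]:
  assumes "pr f" "pr g"
  shows "pr (\<lambda>x. f x # g x)"
proof -
  have "pr (\<lambda>p. fst p # snd p)"
    by (rule prI[OF pr_Suc[OF pr_id]]) (simp add: encode_list_def encode_prod_def)
  then show ?thesis using assms by (rule pr_apply2)
qed

lemma pr_tl [pr]: "pr f \<Longrightarrow> pr (\<lambda>x. tl (f x))"
proof (rule pr_comp[of tl])
  have "pr (rec_nat 0 (\<lambda>n _. snd (prod_decode n)))"
    by (intro pr)
  then show "pr (tl :: 'b list \<Rightarrow> 'b list)"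
  proof (rule prI)
    fix l :: "'b list"
    show "encode (tl l) = rec_nat 0 (\<lambda>n _. snd (prod_decode n)) (encode l)"
      by (cases l) (simp_all add: encode_list_def)
  qed
qed

lemma pr_hd [pr]: "pr f \<Longrightarrow> pr (\<lambda>x. hd (f x))"
proof (rule pr_comp[of hd])
  have "pr (rec_nat (encode (hd ([] :: 'b list))) (\<lambda>n _. fst (prod_decode n)))"
    by (intro pr)
  then show "pr (hd :: 'b list \<Rightarrow> 'b)"
  proof (rule prI)
    fix l :: "'b list"
    show "encode (hd l) = rec_nat (encode (hd ([] :: 'b list))) (\<lambda>n _. fst (prod_decode n)) (encode l)"
      by (cases l) (simp_all add: encode_list_def)
  qed
qed

text \<open>Supplies \<open>pr_fold\<close> with a computable number of iterations; surplus ones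
  meet an empty list and change nothing.\<close>

lemma length_le_encode: "length l \<le> encode l"
proof (induction l)
  case (Cons a l)
  have "encode l \<le> prod_encode (encode a, encode l)" by (rule le_prod_encode_2)
  then show ?case using Cons by (simp add: encode_list_def)
qed simp

lemma pr_fold [pr]:
  assumes h: "pr (\<lambda>p. h (fst p) (fst (snd p)) (snd (snd p)))" and l: "pr l" and a: "pr a"
  shows "pr (\<lambda>x. fold (h x) (l x) (a x))"
proof -
  define step where "step p = (if fst (snd p) = [] then p else
    (fst p, tl (fst (snd p)), h (fst p) (hd (fst (snd p))) (snd (snd p))))" for p
  have "pr (\<lambda>p. h (fst p) (hd (fst (snd p))) (snd (snd p)))"
    by (rule pr_apply3[OF h]) (intro pr)+
  then have step: "pr step" unfolding step_def by (intro pr)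
  have iter: "(step ^^ n) (x, l, b) = (x, drop n l, fold (h x) (take n l) b)" for n x l b
  proof (induction n arbitrary: l b)
    case (Suc n)
    show ?case
    proof (cases l)
      case Nil
      then show ?thesis using Suc[of "[]" b] by (simp add: funpow_Suc_right step_def del: funpow.simps)
    next
      case (Cons y ys)
      then show ?thesis using Suc[of ys "h x y b"] by (simp add: funpow_Suc_right step_def del: funpow.simps)
    qed
  qed simp
  have "pr (\<lambda>x. snd (snd ((step ^^ encode (l x)) (x, l x, a x))))"
    by (intro pr pr_funpow step a l)
  then show ?thesis by (simp add: iter length_le_encode)
qed

lemma pr_rev [pr]:
  assumes "pr f"
  shows "pr (\<lambda>x. rev (f x))"
proof -
  have "pr (\<lambda>x. fold Cons (f x) [])" by (intro pr assms)
  then show ?thesis by (simp add: fold_Cons_rev)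
qed

lemma pr_foldr [pr]:
  assumes "pr (\<lambda>p. h (fst p) (fst (snd p)) (snd (snd p)))" "pr l" "pr a"
  shows "pr (\<lambda>x. foldr (h x) (l x) (a x))"
  unfolding foldr_conv_fold by (intro pr assms)

lemma pr_append [pr]:
  assumes "pr f" "pr g"
  shows "pr (\<lambda>x. f x @ g x)"
proof -
  have "pr (\<lambda>x. foldr Cons (f x) (g x))" by (intro pr assms)
  moreover have "foldr Cons xs ys = xs @ ys" for xs ys :: "'b list"
    by (induction xs) simp_all
  ultimately show ?thesis by simp
qed

lemma pr_map [pr]:
  assumes h: "pr (\<lambda>p. h (fst p) (snd p))" and l: "pr l"
  shows "pr (\<lambda>x. map (h x) (l x))"
proof -
  have "pr (\<lambda>x. foldr (\<lambda>y ys. h x y # ys) (l x) [])"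
    by (intro pr pr_apply2[OF h] l)
  moreover have "foldr (\<lambda>y ys. h x y # ys) l [] = map (h x) l" for x l
    by (induction l) simp_all
  ultimately show ?thesis by simp
qed

lemma pr_filter [pr]:
  assumes h: "pr (\<lambda>p. P (fst p) (snd p))" and l: "pr l"
  shows "pr (\<lambda>x. filter (P x) (l x))"
proof -
  have "pr (\<lambda>x. foldr (\<lambda>y ys. if P x y then y # ys else ys) (l x) [])"
    by (intro pr pr_apply2[OF h] l)
  moreover have "foldr (\<lambda>y ys. if P x y then y # ys else ys) l [] = filter (P x) l" for x l
    by (induction l) simp_all
  ultimately show ?thesis by simp
qed

lemma pr_Ball_set [pr]:
  assumes h: "pr (\<lambda>p. P (fst p) (snd p))" and l: "pr l"
  shows "pr (\<lambda>x. \<forall>y\<in>set (l x). P x y)"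
proof -
  have "pr (\<lambda>x. foldr (\<lambda>y b. P x y \<and> b) (l x) True)"
    by (intro pr pr_apply2[OF h] l)
  moreover have "foldr (\<lambda>y b. P x y \<and> b) l True \<longleftrightarrow> (\<forall>y\<in>set l. P x y)" for x l
    by (induction l) simp_all
  ultimately show ?thesis by simp
qed

lemma pr_Bex_set [pr]:
  assumes h: "pr (\<lambda>p. P (fst p) (snd p))" and l: "pr l"
  shows "pr (\<lambda>x. \<exists>y\<in>set (l x). P x y)"
proof -
  have "pr (\<lambda>x. foldr (\<lambda>y b. P x y \<or> b) (l x) False)"
    by (intro pr pr_apply2[OF h] l)
  moreover have "foldr (\<lambda>y b. P x y \<or> b) l False \<longleftrightarrow> (\<exists>y\<in>set l. P x y)" for x l
    by (induction l) simp_all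
  ultimately show ?thesis by simp
qed

lemma pr_in_set [pr]:
  assumes "pr f" "pr l"
  shows "pr (\<lambda>x. f x \<in> set (l x))"
proof -
  have "pr (\<lambda>x. \<exists>y\<in>set (l x). f x = y)"
    by (intro pr pr_comp[OF assms(1)] assms)
  then show ?thesis by (simp add: eq_commute)
qed

lemma pr_map_of [pr]:
  assumes "pr l" "pr k"
  shows "pr (\<lambda>x. map_of (l x) (k x))"
proof -
  have "pr (\<lambda>x. foldr (\<lambda>e r. if k x = fst e then Some (snd e) else r) (l x) None)"
    by (intro pr pr_comp[OF assms(2)] assms)
  moreover have "foldr (\<lambda>e r. if k = fst e then Some (snd e) else r) l None = map_of l k"
    for k :: 'b and l :: "('b \<times> 'c) list"
    by (induction l) auto
  ultimately show ?thesis by simp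
qed

lemma pr_length [pr]:
  assumes "pr l"
  shows "pr (\<lambda>x. length (l x))"
proof -
  have "pr (\<lambda>x. foldr (\<lambda>_. Suc) (l x) 0)"
    by (intro pr assms)
  moreover have "foldr (\<lambda>_. Suc) l 0 = length l" for l :: "'b list"
    by (induction l) auto
  ultimately show ?thesis by simp
qed

lemma pr_upt [pr]:
  assumes "pr f"
  shows "pr (\<lambda>x. [0..<f x])"
proof -
  have "pr (\<lambda>x. rec_nat [] (\<lambda>i r. r @ [i]) (f x))"
    by (intro pr assms)
  moreover have "rec_nat [] (\<lambda>i r. r @ [i]) n = [0..<n]" for n
    by (induction n) auto
  ultimately show ?thesis by simp
qed

lemma pr_replicate [pr]:
  assumes f: "pr f" and g: "pr g"
  shows "pr (\<lambda>x. replicate (f x) (g x))"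
proof -
  have "pr (\<lambda>x. rec_nat [] (\<lambda>i r. g x # r) (f x))"
    by (intro pr pr_comp[OF g] f)
  moreover have "rec_nat [] (\<lambda>i r. a # r) n = replicate n a" for n and a :: 'b
    by (induction n) auto
  ultimately show ?thesis by simp
qed

lemma pr_count_list [pr]:
  assumes "pr l" "pr k"
  shows "pr (\<lambda>x. count_list (l x) (k x))"
proof -
  have "pr (\<lambda>x. foldr (\<lambda>y r. if y = k x then Suc r else r) (l x) 0)"
    by (intro pr pr_comp[OF assms(2)] assms)
  moreover have "foldr (\<lambda>y r. if y = k then Suc r else r) l 0 = count_list l k"
    for k :: 'b and l :: "'b list"
    by (induction l) auto
  ultimately show ?thesis by simp
qed

lemma pr_zip [pr]:
  assumes "pr f" "pr g"
  shows "pr (\<lambda>x. zip (f x) (g x))"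
proof -
  define step where "step = (\<lambda>(a::'b) r :: 'c list \<times> ('b \<times> 'c) list.
    if fst r = [] then r else (tl (fst r), (a, hd (fst r)) # snd r))"
  have "snd (fold step xs (ys, acc)) = rev (zip xs ys) @ acc" for xs ys acc
  proof (induction xs arbitrary: ys acc)
    case (Cons x xs)
    then show ?case
    proof (cases ys)
      case Nil
      have "fold step xs ([], acc) = ([], acc)" for xs acc
        by (induction xs) (simp_all add: step_def)
      then show ?thesis using Nil by (simp add: step_def)
    qed (simp add: step_def)
  qed simp
  then have "zip xs ys = rev (snd (fold step xs (ys, [])))" for xs ys
    by simp
  moreover have "pr (\<lambda>x. rev (snd (fold step (f x) (g x, []))))"
    unfolding step_def by (intro pr assms)
  ultimately show ?thesis by simp
qed

section \<open>Simulation of Turing machines\<close>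

lemma pr_parametrised: "pr (parametrised m p)"
proof -
  have "pr (\<lambda>n. parametrised m p n)"
    unfolding parametrised_def write_parameter_def write_state_def by (intro pr)
  then show ?thesis by simp
qed

text \<open>A form of the s-m-n theorem: \<open>n\<close> is hard-wired in the writing states, and
  the table depends on it primitive recursively.\<close>

lemma parameter_theorem:
  assumes "pr (g :: nat \<Rightarrow> nat)"
  obtains T :: "nat \<Rightarrow> tm" where "pr T" "\<And>n j. tm_computes (T n) j (g (prod_encode (n, j)))"
  using assms pr_parametrised prn_machine unfolding pr_nat_iff by metis

lemma pr_computable:
  assumes "pr (f :: nat \<Rightarrow> nat)"
  shows "computable f"
proof -
  have "pr (\<lambda>x. f (snd (prod_decode x)))"
    by (rule pr_comp[OF assms]) (intro pr)
  then obtain T :: "nat \<Rightarrow> tm" where "\<And>n j. tm_computes (T n) j (f (snd (prod_decode (prod_encode (n, j)))))"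
    using parameter_theorem by blast
  then show ?thesis unfolding computable_def by auto
qed

lemma pr_decidable:
  assumes "pr (\<lambda>n. n \<in> D)"
  shows "decidable D"
  unfolding decidable_def by (intro pr_computable pr assms)

lemma pr_first_symbol [pr]:
  assumes "pr f"
  shows "pr (\<lambda>x. first_symbol (f x))"
proof -
  have "pr (\<lambda>x. if f x = [] then 0 else hd (f x))" by (intro pr assms)
  moreover have "(if w = [] then 0 else hd w) = first_symbol w" for w
    by (cases w) auto
  ultimately show ?thesis by simp
qed

lemma pr_act [pr]:
  assumes "pr l" "pr r" "pr v"
  shows "pr (\<lambda>x. act (l x) (r x) (v x))"
proof -
  have "pr (\<lambda>x. if snd (snd (v x)) = Left
      then (fst (v x), tl (l x), first_symbol (l x) # fst (snd (v x)) # tl (r x))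
      else (fst (v x), fst (snd (v x)) # l x, tl (r x)))"
    by (intro pr assms)
  moreover have "act l r v = (if snd (snd v) = Left
      then (fst v, tl l, first_symbol l # fst (snd v) # tl r) else (fst v, fst (snd v) # l, tl r))" for l r v
    by (cases "(l, r, v)" rule: act.cases) auto
  ultimately show ?thesis by simp
qed

lemma pr_tm_step [pr]:
  assumes "pr M" "pr c"
  shows "pr (\<lambda>x. tm_step (M x) (c x))"
proof -
  have "pr (\<lambda>x. map_option (act (fst (snd (c x))) (snd (snd (c x))))
      (map_of (M x) (fst (c x), first_symbol (snd (snd (c x))))))"
    by (intro pr assms)
  moreover have "tm_step M c = map_option (act (fst (snd c)) (snd (snd c)))
      (map_of M (fst c, first_symbol (snd (snd c))))" for M c
    by (cases c) simp
  ultimately show ?thesis by simp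
qed

definition run :: "tm \<Rightarrow> nat \<Rightarrow> nat \<Rightarrow> config" where
  "run M n t = rec_nat (0, [], replicate n 1)
     (\<lambda>_ c. case tm_step M c of None \<Rightarrow> c | Some c' \<Rightarrow> c') t"

text \<open>Only the configuration at time \<open>t\<close> is tested; this suffices because a
  halted run stays constant.\<close>

definition result :: "tm \<Rightarrow> nat \<Rightarrow> nat \<Rightarrow> nat option" where
  "result M n t = (if tm_step M (run M n t) = None
     then Some (count_list (fst (snd (run M n t))) 1 + count_list (snd (snd (run M n t))) 1) else None)"

lemma pr_result [pr]:
  assumes M: "pr M" and n: "pr n" and t: "pr t"
  shows "pr (\<lambda>x. result (M x) (n x) (t x))"
  unfolding result_def run_def by (intro pr pr_comp[OF M] assms)

lemma run_Suc: "run M n (Suc t) = (case tm_step M (run M n t) of None \<Rightarrow> run M n t | Some c' \<Rightarrow> c')"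
  unfolding run_def by (simp only: nat.rec)

lemma steps_run: "steps M (0, [], replicate n 1) (run M n t)"
proof (induction t)
  case 0
  show ?case by (simp add: run_def steps_def)
next
  case (Suc t)
  then show ?case
    unfolding run_Suc steps_def
    by (auto simp del: tm_step.simps split: option.split intro: rtranclp.rtrancl_into_rtrancl)
qed

lemma run_complete:
  assumes "steps M (0, [], replicate n 1) c"
  obtains t where "run M n t = c"
proof -
  have "\<exists>t. run M n t = c"
    using assms unfolding steps_def
  proof (induction rule: rtranclp_induct)
    case base
    show ?case by (intro exI[of _ 0]) (simp add: run_def)
  next
    case (step c c')
    then obtain t where "run M n t = c" by blast
    then show ?case using step.hyps(2) by (intro exI[of _ "Suc t"]) (simp add: run_Suc)
  qed
  then show ?thesis using that by blast
qed

lemma tm_computes_iff: "tm_computes M n m \<longleftrightarrow> (\<exists>t. result M n t = Some m)"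
proof
  assume "tm_computes M n m"
  then obtain q l r where c: "steps M (0, [], replicate n 1) (q, l, r)" "tm_step M (q, l, r) = None"
    "m = count_list l 1 + count_list r 1"
    unfolding tm_computes_def steps_def by blast
  from c(1) obtain t where "run M n t = (q, l, r)" by (rule run_complete)
  with c(2,3) show "\<exists>t. result M n t = Some m"
    by (intro exI[of _ t]) (simp add: result_def)
next
  assume "\<exists>t. result M n t = Some m"
  then obtain t where t: "result M n t = Some m" ..
  obtain q l r where "run M n t = (q, l, r)" by (cases "run M n t") auto
  then show "tm_computes M n m"
    using t steps_run[of M n t] unfolding tm_computes_def steps_def result_def
    by (intro exI[of _ q] exI[of _ l] exI[of _ r]) (auto split: if_splits)
qed

lemma result_mono:
  assumes "result M n t = Some m" "t \<le> t'"
  shows "result M n t' = Some m"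
proof -
  have "run M n t' = run M n t"
    using assms(2)
  proof (induction rule: dec_induct)
    case (step k)
    have halted: "tm_step M (run M n t) = None"
      using assms(1) unfolding result_def by (metis option.distinct(1))
    show ?case unfolding run_Suc step.IH halted by simp
  qed simp
  then show ?thesis using assms(1) by (simp only: result_def)
qed

lemma tm_computes_unique: "tm_computes M n m \<Longrightarrow> tm_computes M n m' \<Longrightarrow> m = m'"
  unfolding tm_computes_iff by (metis nat_le_linear option.inject result_mono)

lemma in_enumerated_iff: "m \<in> enumerated M \<longleftrightarrow> (\<exists>n t. result M n t = Some m)"
  by (auto simp: enumerated_def tm_computes_iff)

text \<open>Converts membership into a search over a time bound, whose body is primitive recursive.
  The answer 0 cannot be confused with 1, since outputs are unique.\<close>

lemma decidable_result:
  assumes "decidable D"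
  obtains M where "\<And>x. x \<in> D \<longleftrightarrow> (\<exists>t. result M x t = Some 1)"
proof -
  from assms obtain M where M: "\<And>x. tm_computes M x (if x \<in> D then 1 else 0)"
    unfolding decidable_def computable_def by blast
  have "x \<in> D \<longleftrightarrow> tm_computes M x 1" for x
    using M[of x] tm_computes_unique[of M x 0 1] by (cases "x \<in> D") auto
  then show ?thesis using that unfolding tm_computes_iff by blast
qed

section \<open>Encodings of machines, alphabets and patterns\<close>

lemma tm_code_encode: "tm_code M = encode M"
  by (auto simp: tm_code_def encode_list_def encode_prod_def encode_direction_def intro!: arg_cong[of _ _ list_encode])

text \<open>Total on all numbers, so it also accepts non-codes, for instance a direction code above
  1. Genuine codes are recognised by encoding the decoded machine again.\<close>

definition decode_entry :: "nat \<Rightarrow> (nat \<times> nat) \<times> (nat \<times> nat \<times> direction)" where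
  "decode_entry e = (let k = prod_decode (fst (prod_decode e)); v = prod_decode (snd (prod_decode e))
     in (k, fst v, fst (prod_decode (snd v)), if snd (prod_decode (snd v)) = 0 then Left else Right))"

definition decode_tm :: "nat \<Rightarrow> tm" where
  "decode_tm c = map decode_entry (list_decode c)"

lemma decode_entry_encode: "decode_entry (encode e) = e"
proof -
  obtain q a q' b D where "e = ((q, a), q', b, D)" by (metis prod.collapse)
  then show ?thesis
    by (cases D) (simp_all add: decode_entry_def encode_prod_def encode_direction_def)
qed

lemma decode_tm_encode: "decode_tm (encode M) = M"
  by (simp add: decode_tm_def encode_list_def decode_entry_encode o_def)

lemma pr_decode_tm [pr]:
  assumes "pr f"
  shows "pr (\<lambda>x. decode_tm (f x))"
  unfolding decode_tm_def decode_entry_def Let_def by (intro pr assms)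

lemma input_code_iff:
  assumes "finite A"
  shows "e = input_code A M \<longleftrightarrow> A = set_decode (fst (prod_decode e)) \<and>
    M = decode_tm (snd (prod_decode e)) \<and> encode M = snd (prod_decode e)"
proof
  assume "e = input_code A M"
  then show "A = set_decode (fst (prod_decode e)) \<and>
      M = decode_tm (snd (prod_decode e)) \<and> encode M = snd (prod_decode e)"
    using assms by (simp add: input_code_def tm_code_encode decode_tm_encode set_encode_inverse)
next
  assume "A = set_decode (fst (prod_decode e)) \<and>
      M = decode_tm (snd (prod_decode e)) \<and> encode M = snd (prod_decode e)"
  then show "e = input_code A M"
    by (metis input_code_def tm_code_encode set_decode_inverse prod.collapse prod_decode_inverse)
qed

definition entries :: "nat \<Rightarrow> (point \<times> nat) list" where
  "entries c = map (\<lambda>e. case prod_decode e of (s, a) \<Rightarrow> (map int_decode (list_decode s), a)) (list_decode c)"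

lemma pattern_of_entries: "pattern_of c = map_of (entries c)"
  by (simp add: pattern_of_def entries_def)

lemma pr_entries [pr]:
  assumes "pr f"
  shows "pr (\<lambda>x. entries (f x))"
  unfolding entries_def by (intro pr assms)

definition is_pattern :: "nat \<Rightarrow> nat \<Rightarrow> (point \<times> nat) list \<Rightarrow> bool" where
  "is_pattern d A l \<longleftrightarrow>
     (\<forall>e\<in>set l. length (fst e) = d \<and> the (map_of l (fst e)) \<in> set_decode A)"

lemma is_pattern_iff: "is_pattern d A l \<longleftrightarrow> map_of l \<in> patterns d (set_decode A)"
proof -
  have dom: "dom (map_of l) = fst ` set l" by (rule dom_map_of_conv_image_fst)
  have ran: "ran (map_of l) = (\<lambda>s. the (map_of l s)) ` fst ` set l"
    unfolding dom[symmetric] by (force simp: ran_def dom_def image_iff)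
  then show ?thesis
    unfolding patterns_def is_pattern_def mem_Collect_eq ran unfolding dom points_def
    by (simp add: image_subset_iff) blast
qed

lemma pr_is_pattern [pr]:
  assumes A: "pr A" and l: "pr l"
  shows "pr (\<lambda>x. is_pattern d (A x) (l x))"
  unfolding is_pattern_def by (intro pr pr_comp[OF A] pr_comp[OF l] assms)

lemma pr_shift_by [pr]:
  assumes "pr u" "pr s"
  shows "pr (\<lambda>x. shift_by (u x) (s x))"
  unfolding shift_by_def by (intro pr assms)

section \<open>Inclusion of subshifts by refutations\<close>

text \<open>
  \<open>q\<close> is refutable if no configuration of the subshift extends it; by compactness this has a finite
  proof tree. New entries are appended, so that they cannot change the pattern \<open>map_of q\<close>.
\<close>

inductive refutable :: "nat \<Rightarrow> nat set \<Rightarrow> pattern set \<Rightarrow> (point \<times> nat) list \<Rightarrow> bool"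
  for d A F where
  contains: "u \<in> points d \<Longrightarrow> p \<in> F \<Longrightarrow> \<forall>s\<in>dom p. map_of q (shift_by u s) = p s \<Longrightarrow>
    refutable d A F q"
| branch: "u \<in> points d \<Longrightarrow> (\<And>a. a \<in> A \<Longrightarrow> refutable d A F (q @ [(u, a)])) \<Longrightarrow> refutable d A F q"

definition agrees :: "(point \<Rightarrow> nat) \<Rightarrow> (point \<times> nat) list \<Rightarrow> bool" where
  "agrees x q \<longleftrightarrow> (\<forall>s a. map_of q s = Some a \<longrightarrow> x s = a)"

lemma refutable_sound:
  assumes "refutable d A F q" "x \<in> avoiding d A F"
  shows "\<not> agrees x q"
  using assms(1)
proof induction
  case (contains u p q)
  show ?case
  proof
    assume "agrees x q"
    then have "Some (x (shift_by u s)) = p s" if "s \<in> dom p" for s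
      using contains(3) that by (force simp: agrees_def)
    then have "appears d p x" using contains(1) by (auto simp: appears_def)
    then show False using contains(2) assms(2) by (auto simp: avoiding_def)
  qed
next
  case (branch u q)
  have "x u \<in> A"
    using assms(2) branch(1) by (auto simp: avoiding_def configurations_def)
  then have "\<not> agrees x (q @ [(u, x u)])" by (rule branch.IH)
  then show ?case
    by (auto simp: agrees_def map_add_def split: option.splits if_splits)
qed

lemma length_shift_by: "length u = d \<Longrightarrow> length s = d \<Longrightarrow> length (shift_by u s) = d"
  by (simp add: shift_by_def)

text \<open>Compactness by hand: all points are visited in turn, and each receives a symbol that
  keeps the pattern non-refutable, which exists by the rule \<open>branch\<close>. A forbidden
  pattern in the limit would already be visible at a finite stage and refute it.\<close>

lemma not_refutable_extends:
  assumes F: "F \<subseteq> patterns d A" and q: "map_of q \<in> patterns d A" and "\<not> refutable d A F q"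
  obtains x where "x \<in> avoiding d A F" "agrees x q"
proof -
  define pt where "pt i = map int_decode (list_decode i)" for i
  define idx where "idx u = list_encode (map int_encode u)" for u
  have pt_idx: "pt (idx u) = u" for u
    by (simp add: pt_def idx_def o_def)
  \<comment> \<open>Every integer list occurs as some \<open>pt i\<close>; lists of length other
    than \<open>d\<close> are skipped.\<close>
  define Q where "Q = rec_nat q (\<lambda>i r. if length (pt i) = d
     then r @ [(pt i, SOME a. a \<in> A \<and> \<not> refutable d A F (r @ [(pt i, a)]))] else r)"
  have Q_0: "Q 0 = q" by (simp add: Q_def)
  have Q_Suc: "Q (Suc i) = (if length (pt i) = d
     then Q i @ [(pt i, SOME a. a \<in> A \<and> \<not> refutable d A F (Q i @ [(pt i, a)]))] else Q i)" for i
    by (simp add: Q_def)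
  have invariant: "\<not> refutable d A F (Q i) \<and> (\<forall>s a. map_of (Q i) s = Some a \<longrightarrow> a \<in> A)" for i
  proof (induction i)
    case 0
    show ?case using assms(3) q by (auto simp: Q_0 patterns_def ran_def)
  next
    case (Suc i)
    show ?case
    proof (cases "length (pt i) = d")
      case True
      then have "\<exists>a. a \<in> A \<and> \<not> refutable d A F (Q i @ [(pt i, a)])"
        using Suc refutable.branch[of "pt i" d A F "Q i"] by (auto simp: points_def)
      from someI_ex[OF this] show ?thesis
        using Suc True by (auto simp: Q_Suc map_add_def split: option.splits if_splits)
    qed (use Suc in \<open>simp add: Q_Suc\<close>)
  qed
  have mono: "map_of (Q j) s = Some a" if "map_of (Q i) s = Some a" "i \<le> j" for i j s a
    using that(2)
  proof (induction rule: dec_induct)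
    case (step k)
    then show ?case by (auto simp: Q_Suc)
  qed (rule that(1))
  have total: "\<exists>a. map_of (Q (Suc (idx u))) u = Some a" if "u \<in> points d" for u
    using that by (cases "map_of (Q (idx u)) u") (auto simp: Q_Suc pt_idx points_def map_add_def)
  define x where "x u = (if u \<in> points d then the (map_of (Q (Suc (idx u))) u) else undefined)" for u
  have x_stage: "map_of (Q i) u = Some (x u)" if "Suc (idx u) \<le> i" "u \<in> points d" for i u
    using total[OF that(2)] mono[OF _ that(1)] that(2) by (auto simp: x_def)
  have x_eq: "x u = a" if "map_of (Q i) u = Some a" "u \<in> points d" for i u a
    using x_stage[of u "max i (Suc (idx u))"] mono[OF that(1), of "max i (Suc (idx u))"] that(2) by simp
  have "x \<in> configurations d A"
    unfolding configurations_def
  proof (rule PiE_I)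
    fix u assume "u \<in> points d"
    then show "x u \<in> A" using x_stage[of u "Suc (idx u)"] invariant by blast
  qed (simp add: x_def)
  moreover have "\<not> appears d p x" if p: "p \<in> F" for p
  proof
    assume "appears d p x"
    then obtain w where w: "w \<in> points d" "\<forall>s\<in>dom p. Some (x (shift_by w s)) = p s"
      by (auto simp: appears_def)
    have dom: "finite (dom p)" "dom p \<subseteq> points d"
      using p F by (auto simp: patterns_def)
    \<comment> \<open>The sum exceeds the index of each point of the translated support, so stage
      \<open>I\<close> has assigned all of them.\<close>
    define I where "I = (\<Sum>s\<in>dom p. Suc (idx (shift_by w s)))"
    have "map_of (Q I) (shift_by w s) = p s" if s: "s \<in> dom p" for s
    proof -
      have "Suc (idx (shift_by w s)) \<le> I"
        unfolding I_def using dom(1) s by (intro member_le_sum) auto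
      moreover have "shift_by w s \<in> points d"
        using w(1) s dom(2) by (auto simp: points_def intro!: length_shift_by)
      ultimately show ?thesis using x_stage w(2) s by simp
    qed
    then have "refutable d A F (Q I)" using refutable.contains[OF w(1) p] by blast
    then show False using invariant by blast
  qed
  ultimately have "x \<in> avoiding d A F" by (simp add: avoiding_def)
  moreover have "agrees x q"
    unfolding agrees_def
  proof (intro allI impI)
    fix s a assume "map_of q s = Some a"
    moreover from this have "s \<in> points d" using q by (auto simp: patterns_def)
    ultimately show "x s = a" using x_eq[of 0] by (simp add: Q_0)
  qed
  ultimately show ?thesis by (rule that)
qed

section \<open>Shift invariance and the criterion for inclusion\<close>

lemma shift_by_zero: "s \<in> points d \<Longrightarrow> shift_by (replicate d 0) s = s"
  by (auto simp: shift_by_def points_def intro: nth_equalityI)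

lemma shift_by_zero_right: "s \<in> points d \<Longrightarrow> shift_by s (replicate d 0) = s"
  by (auto simp: shift_by_def points_def intro: nth_equalityI)

lemma shift_by_assoc: "shift_by u (shift_by v w) = shift_by (shift_by u v) w"
proof (rule nth_equalityI)
  fix i assume "i < length (shift_by u (shift_by v w))"
  then show "shift_by u (shift_by v w) ! i = shift_by (shift_by u v) w ! i"
    by (simp add: shift_by_def)
qed (simp add: shift_by_def)

text \<open>Refutations concern a pattern at its fixed place, occurrences any translate; shifting
  the configuration reconciles the two.\<close>

lemma avoiding_shift:
  assumes F: "F \<subseteq> patterns d A" and x: "x \<in> avoiding d A F" and u: "u \<in> points d"
  shows "(\<lambda>s. if s \<in> points d then x (shift_by u s) else undefined) \<in> avoiding d A F" (is "?y \<in> _")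
proof -
  have shift: "shift_by v s \<in> points d" if "v \<in> points d" "s \<in> points d" for v s
    using that by (auto simp: points_def intro!: length_shift_by)
  have "?y \<in> configurations d A"
    using x u shift by (auto simp: avoiding_def configurations_def PiE_iff extensional_def)
  moreover have "\<not> appears d p ?y" if p: "p \<in> F" for p
  proof
    assume "appears d p ?y"
    then obtain w where w: "w \<in> points d" "\<forall>s\<in>dom p. Some (?y (shift_by w s)) = p s"
      by (auto simp: appears_def)
    have "Some (x (shift_by (shift_by u w) s)) = p s" if s: "s \<in> dom p" for s
    proof -
      have "s \<in> points d" using s p F unfolding patterns_def by blast
      then have "shift_by w s \<in> points d" by (rule shift[OF w(1)])
      then show ?thesis
        using w(2)[rule_format, OF s] by (simp add: shift_by_assoc)
    qed
    then have "appears d p x" using shift[OF u w(1)] by (auto simp: appears_def)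
    then show False using x p by (auto simp: avoiding_def)
  qed
  ultimately show ?thesis by (simp add: avoiding_def)
qed

text \<open>A symbol of \<open>A\<close> outside \<open>B\<close> acts as a forbidden one-point
  pattern. Conversely, a forbidden pattern with values outside \<open>A\<close> cannot occur in a
  configuration over \<open>A\<close>, so no refutation of it is asked for.\<close>

lemma avoiding_subset_iff:
  assumes F: "F \<subseteq> patterns d A" and L: "map_of ` L \<subseteq> patterns d B"
  shows "avoiding d A F \<subseteq> avoiding d B (map_of ` L) \<longleftrightarrow>
    (\<forall>a. a \<in> A \<and> a \<notin> B \<longrightarrow> refutable d A F [(replicate d 0, a)]) \<and>
    (\<forall>q\<in>L. map_of q \<in> patterns d A \<longrightarrow> refutable d A F q)" (is "_ \<longleftrightarrow> ?single \<and> ?patterns")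
proof
  assume sub: "avoiding d A F \<subseteq> avoiding d B (map_of ` L)"
  have ?single
  proof (intro allI impI, elim conjE, rule ccontr)
    fix a assume a: "a \<in> A" "a \<notin> B" "\<not> refutable d A F [(replicate d 0, a)]"
    have "map_of [(replicate d 0, a)] \<in> patterns d A"
      using a(1) by (auto simp: patterns_def points_def)
    from not_refutable_extends[OF F this a(3)] obtain x where
      x: "x \<in> avoiding d A F" "agrees x [(replicate d 0, a)]" .
    have "x (replicate d 0) = a" using x(2) by (simp add: agrees_def)
    moreover have "x \<in> points d \<rightarrow>\<^sub>E B"
      using sub x(1) by (auto simp: avoiding_def configurations_def)
    then have "x (replicate d 0) \<in> B" by (rule PiE_mem) (simp add: points_def)
    ultimately show False using a(2) by simp
  qed
  moreover have ?patterns
  proof (intro ballI impI, rule ccontr)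
    fix q assume q: "q \<in> L" "map_of q \<in> patterns d A" "\<not> refutable d A F q"
    from not_refutable_extends[OF F q(2,3)] obtain x where x: "x \<in> avoiding d A F" "agrees x q" .
    have "Some (x (shift_by (replicate d 0) s)) = map_of q s" if "s \<in> dom (map_of q)" for s
    proof -
      have "s \<in> points d" using that q(2) by (auto simp: patterns_def)
      then show ?thesis using that x(2) by (auto simp: shift_by_zero agrees_def)
    qed
    then have "appears d (map_of q) x"
      unfolding appears_def by (intro bexI[of _ "replicate d 0"]) (auto simp: points_def)
    then show False using sub x(1) q(1) by (auto simp: avoiding_def)
  qed
  ultimately show "?single \<and> ?patterns" ..
next
  assume single_patterns: "?single \<and> ?patterns"
  show "avoiding d A F \<subseteq> avoiding d B (map_of ` L)"
  proof
    fix x assume x: "x \<in> avoiding d A F"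
    \<comment> \<open>\<open>y u\<close> is the translate of \<open>x\<close> that carries the point
      \<open>u\<close> to the origin.\<close>
    define y where "y u s = (if s \<in> points d then x (shift_by u s) else undefined)" for u s
    have y: "y u \<in> avoiding d A F" if "u \<in> points d" for u
      unfolding y_def using avoiding_shift[OF F x that] .
    have "x u \<in> B" if u: "u \<in> points d" for u
    proof (rule ccontr)
      assume "x u \<notin> B"
      moreover have "x u \<in> A" using x u by (auto simp: avoiding_def configurations_def)
      ultimately have "refutable d A F [(replicate d 0, x u)]" using single_patterns by blast
      moreover have "y u (replicate d 0) = x u"
        using u by (simp add: y_def shift_by_zero_right) (simp add: points_def)
      then have "agrees (y u) [(replicate d 0, x u)]"
        by (simp add: agrees_def)
      ultimately show False using refutable_sound y[OF u] by blast
    qed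
    then have "x \<in> configurations d B"
      using x by (auto simp: avoiding_def configurations_def PiE_iff)
    moreover have "\<not> appears d (map_of q) x" if q: "q \<in> L" for q
    proof
      assume "appears d (map_of q) x"
      then obtain u where u: "u \<in> points d" "\<forall>s\<in>dom (map_of q). Some (x (shift_by u s)) = map_of q s"
        by (auto simp: appears_def)
      have pat: "map_of q \<in> patterns d B" using q L by blast
      have y_eq: "Some (y u s) = map_of q s" if "s \<in> dom (map_of q)" for s
        using that u(2) pat by (auto simp: y_def patterns_def)
      have "y u s \<in> A" if "s \<in> points d" for s
        using y[OF u(1)] that by (auto simp: avoiding_def configurations_def)
      then have "map_of q \<in> patterns d A"
        using pat y_eq unfolding patterns_def ran_def
        by (smt (verit) domI mem_Collect_eq option.inject subset_iff)
      then have "refutable d A F q" using single_patterns q by blast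
      moreover have "agrees (y u) q"
        using y_eq unfolding agrees_def by (metis domI option.inject)
      ultimately show False using refutable_sound y[OF u(1)] by blast
    qed
    ultimately show "x \<in> avoiding d B (map_of ` L)" by (auto simp: avoiding_def)
  qed
qed

subsection \<open>Certificates\<close>

definition symbols :: "nat \<Rightarrow> nat list" where
  "symbols A = filter (\<lambda>a. a \<in> set_decode A) [0..<A]"

lemma set_symbols [simp]: "set (symbols A) = set_decode A"
proof -
  have "a < A" if "a \<in> set_decode A" for a
  proof -
    have "A div 2 ^ a \<noteq> 0" using that by (auto simp: set_decode_def elim: oddE)
    then have "2 ^ a \<le> A" by (metis div_less not_less)
    then show ?thesis using less_exp[of a] by linarith
  qed
  then show ?thesis by (auto simp: symbols_def)
qed

lemma pr_symbols [pr]: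
  assumes "pr A"
  shows "pr (\<lambda>x. symbols (A x))"
  unfolding symbols_def by (intro pr pr_comp[OF assms] assms)

text \<open>
  A line \<open>(q, u, n, t)\<close> claims that \<open>q\<close> is refutable, either by branching at \<open>u\<close> or because the
  pattern that the machine outputs on input \<open>n\<close> within \<open>t\<close> steps occurs in \<open>q\<close> at \<open>u\<close>.
\<close>

type_synonym line = "(point \<times> nat) list \<times> point \<times> nat \<times> nat"

text \<open>Comparing with \<open>map_of (entries m)\<close> instead of \<open>snd e\<close>
  respects the convention that the first entry for a point counts.\<close>

definition occurs :: "tm \<Rightarrow> line \<Rightarrow> bool" where
  "occurs M l = (case result M (fst (snd (snd l))) (snd (snd (snd l))) of None \<Rightarrow> False
     | Some m \<Rightarrow> \<forall>e\<in>set (entries m).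
         map_of (fst l) (shift_by (fst (snd l)) (fst e)) = map_of (entries m) (fst e))"

text \<open>\<open>acc\<close> collects the claims proved so far. An unjustified line is ignored
  rather than rejected, so every list of lines is a valid certificate of what it derives.\<close>

definition derive_step :: "nat \<Rightarrow> nat \<Rightarrow> tm \<Rightarrow> line \<Rightarrow> (point \<times> nat) list list \<Rightarrow> (point \<times> nat) list list" where
  "derive_step d A M l acc =
     (if length (fst (snd l)) = d \<and>
         ((\<forall>a\<in>set (symbols A). fst l @ [(fst (snd l), a)] \<in> set acc) \<or> occurs M l)
      then fst l # acc else acc)"

definition derived :: "nat \<Rightarrow> nat \<Rightarrow> tm \<Rightarrow> line list \<Rightarrow> (point \<times> nat) list list \<Rightarrow> (point \<times> nat) list list" where
  "derived d A M ls acc = fold (derive_step d A M) ls acc"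

lemma pr_occurs [pr]:
  assumes M: "pr M" and l: "pr l"
  shows "pr (\<lambda>x. occurs (M x) (l x))"
  unfolding occurs_def by (intro pr pr_comp[OF M] pr_comp[OF l] assms)

lemma pr_derive [pr]:
  assumes A: "pr A" and M: "pr M" and "pr ls" "pr acc"
  shows "pr (\<lambda>x. derived d (A x) (M x) (ls x) (acc x))"
  unfolding derived_def derive_step_def by (intro pr pr_comp[OF A] pr_comp[OF M] assms)

lemma derived_Nil [simp]: "derived d A M [] acc = acc"
  and derived_Cons [simp]: "derived d A M (l # ls) acc = derived d A M ls (derive_step d A M l acc)"
  and derived_append [simp]: "derived d A M (ls @ ls') acc = derived d A M ls' (derived d A M ls acc)"
  by (simp_all add: derived_def)

lemma derive_step_mono: "set acc \<subseteq> set acc' \<Longrightarrow> set (derive_step d A M l acc) \<subseteq> set (derive_step d A M l acc')"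
  by (auto simp: derive_step_def)

lemma derive_mono: "set acc \<subseteq> set acc' \<Longrightarrow> set (derived d A M ls acc) \<subseteq> set (derived d A M ls acc')"
  by (induction ls arbitrary: acc acc') (simp_all add: derive_step_mono)

lemma derive_increasing: "set acc \<subseteq> set (derived d A M ls acc)"
proof (induction ls arbitrary: acc)
  case (Cons l ls)
  have "set acc \<subseteq> set (derive_step d A M l acc)" by (auto simp: derive_step_def)
  then show ?case using Cons[of "derive_step d A M l acc"] by simp
qed simp

lemma derive_sound:
  assumes "\<forall>q\<in>set acc. refutable d (set_decode A) (enumerated_patterns M) q"
  shows "\<forall>q\<in>set (derived d A M ls acc). refutable d (set_decode A) (enumerated_patterns M) q"
  using assms
proof (induction ls arbitrary: acc)
  case (Cons l ls)
  obtain q u n t where l: "l = (q, u, n, t)" by (cases l) auto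
  have "refutable d (set_decode A) (enumerated_patterns M) q"
    if "length u = d" "(\<forall>a\<in>set_decode A. q @ [(u, a)] \<in> set acc) \<or> occurs M l"
    using that(2)
  proof
    assume "\<forall>a\<in>set_decode A. q @ [(u, a)] \<in> set acc"
    with Cons.prems have "refutable d (set_decode A) (enumerated_patterns M) (q @ [(u, a)])"
      if "a \<in> set_decode A" for a using that by blast
    with that(1) show ?thesis using branch[of u] by (simp add: points_def)
  next
    assume "occurs M l"
    then obtain m where m: "result M n t = Some m"
      "\<forall>e\<in>set (entries m). map_of q (shift_by u (fst e)) = map_of (entries m) (fst e)"
      by (auto simp: occurs_def l split: option.splits)
    have "m \<in> enumerated M" using m(1) in_enumerated_iff by blast
    then have "pattern_of m \<in> enumerated_patterns M" by (simp add: enumerated_patterns_def)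
    moreover have "\<forall>s\<in>dom (pattern_of m). map_of q (shift_by u s) = pattern_of m s"
      using m(2) by (auto simp: pattern_of_entries dom_map_of_conv_image_fst)
    ultimately show ?thesis using that(1) contains[of u] by (simp add: points_def)
  qed
  then have "\<forall>r\<in>set (derive_step d A M l acc). refutable d (set_decode A) (enumerated_patterns M) r"
    using Cons.prems by (auto simp: derive_step_def l)
  then show ?case using Cons.IH by simp
qed simp

text \<open>Finitely many proofs can be concatenated: earlier claims are never lost, and additional
  ones never invalidate a line. It serves the rule \<open>branch\<close>, whose premises range over
  a finite alphabet.\<close>

lemma derive_simultaneously:
  assumes "finite S" "\<And>a. a \<in> S \<Longrightarrow> \<exists>ls. f a \<in> set (derived d A M ls [])"
  shows "\<exists>ls. \<forall>a\<in>S. f a \<in> set (derived d A M ls [])"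
  using assms
proof (induction S)
  case (insert a S)
  then obtain ls ls' where ls: "\<forall>b\<in>S. f b \<in> set (derived d A M ls [])" "f a \<in> set (derived d A M ls' [])"
    by (metis insertCI)
  have "set (derived d A M ls []) \<subseteq> set (derived d A M (ls @ ls') [])"
    by (simp add: derive_increasing)
  moreover have "set (derived d A M ls' []) \<subseteq> set (derived d A M (ls @ ls') [])"
    by (simp add: derive_mono)
  ultimately show ?case using ls by (intro exI[of _ "ls @ ls'"]) blast
qed simp

lemma refutable_iff_derive:
  "refutable d (set_decode A) (enumerated_patterns M) q \<longleftrightarrow> (\<exists>ls. q \<in> set (derived d A M ls []))"
proof
  assume "refutable d (set_decode A) (enumerated_patterns M) q"
  then show "\<exists>ls. q \<in> set (derived d A M ls [])"
  proof induction
    case (contains u p q)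
    then obtain m n t where m: "p = pattern_of m" "result M n t = Some m"
      by (auto simp: enumerated_patterns_def in_enumerated_iff)
    have "\<forall>e\<in>set (entries m). map_of q (shift_by u (fst e)) = map_of (entries m) (fst e)"
      using contains(3) by (auto simp: m(1) pattern_of_entries dom_map_of_conv_image_fst)
    then show ?case using contains(1) m(2)
      by (intro exI[of _ "[(q, u, n, t)]"]) (simp add: derive_step_def occurs_def points_def)
  next
    case (branch u q)
    have "\<exists>ls. \<forall>a\<in>set_decode A. q @ [(u, a)] \<in> set (derived d A M ls [])"
      by (rule derive_simultaneously) (use branch.IH in auto)
    then obtain ls where "\<forall>a\<in>set_decode A. q @ [(u, a)] \<in> set (derived d A M ls [])" ..
    \<comment> \<open>The two zeros are arbitrary: the last line is justified by branching.\<close>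
    then show ?case using branch(1)
      by (intro exI[of _ "ls @ [(q, u, 0, 0)]"]) (simp add: derive_step_def points_def)
  qed
qed (use derive_sound[of "[]"] in auto)

definition decode_lines :: "nat \<Rightarrow> line list" where
  "decode_lines c = map (\<lambda>e. (entries (fst (prod_decode e)),
     map int_decode (list_decode (fst (prod_decode (snd (prod_decode e))))),
     prod_decode (snd (prod_decode (snd (prod_decode e)))))) (list_decode c)"

text \<open>Surjectivity of \<open>decode_lines\<close> is the point: a search over numbers reaches
  every list of lines.\<close>

lemma decode_lines_encode: "decode_lines (encode ls) = ls"
proof -
  have point: "map int_decode (list_decode (encode u)) = u" for u :: point
    by (simp add: encode_list_def encode_int_def o_def)
  have "entries (encode q) = q" for q
    unfolding entries_def encode_list_def[of q]
    by (auto simp: o_def encode_prod_def point intro!: map_idI)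
  then show ?thesis
    unfolding decode_lines_def encode_list_def[of ls]
    by (auto simp: o_def encode_prod_def point intro!: map_idI)
qed

lemma pr_decode_lines [pr]:
  assumes "pr f"
  shows "pr (\<lambda>x. decode_lines (f x))"
  unfolding decode_lines_def by (intro pr assms)

lemma refutable_iff_certificate:
  "refutable d (set_decode A) (enumerated_patterns M) q \<longleftrightarrow>
    (\<exists>c. q \<in> set (derived d A M (decode_lines c) []))"
  unfolding refutable_iff_derive by (metis decode_lines_encode)

section \<open>Membership in the second level\<close>

text \<open>The matrix of an inclusion: \<open>a\<close> is a symbol, \<open>n\<close> and
  \<open>t\<close> a run of the second machine, \<open>c\<close> and \<open>c'\<close> certificates.
  A run that has not halted by time \<open>t\<close> demands nothing.\<close>

definition covers :: "nat \<Rightarrow> nat \<Rightarrow> tm \<Rightarrow> nat \<Rightarrow> tm \<Rightarrow> nat \<Rightarrow> nat \<Rightarrow> nat \<Rightarrow> nat \<Rightarrow> nat \<Rightarrow> bool" where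
  "covers d A M B N a n t c c' \<longleftrightarrow>
     (a \<in> set_decode A \<and> \<not> a \<in> set_decode B \<longrightarrow>
        [(replicate d 0, a)] \<in> set (derived d A M (decode_lines c) [])) \<and>
     (case result N n t of None \<Rightarrow> True
      | Some m \<Rightarrow> is_pattern d A (entries m) \<longrightarrow>
          entries m \<in> set (derived d A M (decode_lines c') []))"

lemma pr_covers [pr]:
  assumes "pr A" "pr M" "pr B" "pr N" "pr a" "pr n" "pr t" "pr c" "pr c'"
  shows "pr (\<lambda>x. covers d (A x) (M x) (B x) (N x) (a x) (n x) (t x) (c x) (c' x))"
  unfolding covers_def by (intro pr assms)

lemma subshift_subset_iff:
  assumes "specifies d (set_decode A) M" "specifies d (set_decode B) N"
  shows "subshift_of d (set_decode A) M \<subseteq> subshift_of d (set_decode B) N \<longleftrightarrow>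
    (\<forall>a n t. \<exists>c c'. covers d A M B N a n t c c')"
proof -
  have eq: "enumerated_patterns N = map_of ` entries ` enumerated N"
    by (auto simp: enumerated_patterns_def pattern_of_entries)
  have "subshift_of d (set_decode A) M \<subseteq> subshift_of d (set_decode B) N \<longleftrightarrow>
    (\<forall>a. a \<in> set_decode A \<and> a \<notin> set_decode B \<longrightarrow>
      refutable d (set_decode A) (enumerated_patterns M) [(replicate d 0, a)]) \<and>
    (\<forall>q\<in>entries ` enumerated N. map_of q \<in> patterns d (set_decode A) \<longrightarrow>
      refutable d (set_decode A) (enumerated_patterns M) q)"
    unfolding subshift_of_def eq
    by (rule avoiding_subset_iff) (use assms in \<open>auto simp: specifies_def simp flip: eq\<close>)
  also have "\<dots> \<longleftrightarrow> (\<forall>a n t. \<exists>c c'. covers d A M B N a n t c c')"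
  proof -
    have "(\<exists>c'. case result N n t of None \<Rightarrow> True
        | Some m \<Rightarrow> is_pattern d A (entries m) \<longrightarrow> entries m \<in> set (derived d A M (decode_lines c') []))
      \<longleftrightarrow> (\<forall>m. result N n t = Some m \<longrightarrow> map_of (entries m) \<in> patterns d (set_decode A) \<longrightarrow>
        refutable d (set_decode A) (enumerated_patterns M) (entries m))" for n t
      unfolding refutable_iff_certificate is_pattern_iff by (cases "result N n t") auto
    then have "(\<forall>a n t. \<exists>c c'. covers d A M B N a n t c c') \<longleftrightarrow>
      (\<forall>a. a \<in> set_decode A \<and> a \<notin> set_decode B \<longrightarrow>
        refutable d (set_decode A) (enumerated_patterns M) [(replicate d 0, a)]) \<and>
      (\<forall>n t m. result N n t = Some m \<longrightarrow> map_of (entries m) \<in> patterns d (set_decode A) \<longrightarrow>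
        refutable d (set_decode A) (enumerated_patterns M) (entries m))"
      unfolding covers_def refutable_iff_certificate by fast
    then show ?thesis unfolding ball_simps unfolding Ball_def in_enumerated_iff by blast
  qed
  finally show ?thesis .
qed

text \<open>Being an admissible input amounts to a decidable check of the machine code and a
  universal condition on runs, so it fits into the same quantifier prefix as the two
  inclusions.\<close>

lemma in_equality_problem_iff:
  assumes N: "specifies d B N"
  shows "e \<in> equality_problem d (subshift_of d B N) \<longleftrightarrow>
    (let A = fst (prod_decode e); M = decode_tm (snd (prod_decode e)); B' = set_encode B in
      encode M = snd (prod_decode e) \<and>
      (\<forall>n t. case result M n t of None \<Rightarrow> True | Some m \<Rightarrow> is_pattern d A (entries m)) \<and>
      (\<forall>a n t. \<exists>c c'. covers d A M B' N a n t c c') \<and>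
      (\<forall>a n t. \<exists>c c'. covers d B' N A M a n t c c'))"
proof -
  define A where "A = fst (prod_decode e)"
  define M where "M = decode_tm (snd (prod_decode e))"
  have B: "set_decode (set_encode B) = B"
    using N by (simp add: specifies_def set_encode_inverse)
  have "e \<in> equality_problem d (subshift_of d B N) \<longleftrightarrow> encode M = snd (prod_decode e) \<and>
      specifies d (set_decode A) M \<and> subshift_of d (set_decode A) M = subshift_of d B N"
  proof
    assume "e \<in> equality_problem d (subshift_of d B N)"
    then obtain A' M' where *: "e = input_code A' M'" "specifies d A' M'"
      "subshift_of d A' M' = subshift_of d B N"
      unfolding equality_problem_def by blast
    then have "finite A'" by (simp add: specifies_def)
    with *(1) have "A' = set_decode A" "M' = M" "encode M' = snd (prod_decode e)"
      using input_code_iff[of A' e M'] unfolding A_def M_def by blast+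
    then show "encode M = snd (prod_decode e) \<and> specifies d (set_decode A) M \<and>
        subshift_of d (set_decode A) M = subshift_of d B N"
      using *(2,3) by (simp only:)
  next
    assume *: "encode M = snd (prod_decode e) \<and> specifies d (set_decode A) M \<and>
        subshift_of d (set_decode A) M = subshift_of d B N"
    then have "e = input_code (set_decode A) M"
      using input_code_iff[of "set_decode A" e M] by (simp add: A_def M_def)
    then show "e \<in> equality_problem d (subshift_of d B N)"
      using * unfolding equality_problem_def by blast
  qed
  moreover have "specifies d (set_decode A) M \<longleftrightarrow>
      (\<forall>n t. case result M n t of None \<Rightarrow> True | Some m \<Rightarrow> is_pattern d A (entries m))"
    unfolding specifies_def is_pattern_iff enumerated_patterns_def image_subset_iff Ball_def
      in_enumerated_iff pattern_of_entries
    by (simp split: option.split) blast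
  ultimately show ?thesis
    using subshift_subset_iff[of d A M "set_encode B" N] subshift_subset_iff[of d "set_encode B" N A M] N
    unfolding Let_def A_def[symmetric] M_def[symmetric] B by blast
qed

lemma Pi2_equality_problem:
  assumes N: "specifies d B N"
  shows "Pi2 (equality_problem d (subshift_of d B N))"
proof -
  define P where "P e a n t b1 b2 b3 b4 \<longleftrightarrow>
      encode (decode_tm (snd (prod_decode e))) = snd (prod_decode e) \<and>
      (case result (decode_tm (snd (prod_decode e))) n t of None \<Rightarrow> True
        | Some m \<Rightarrow> is_pattern d (fst (prod_decode e)) (entries m)) \<and>
      covers d (fst (prod_decode e)) (decode_tm (snd (prod_decode e))) (set_encode B) N a n t b1 b2 \<and>
      covers d (set_encode B) N (fst (prod_decode e)) (decode_tm (snd (prod_decode e))) a n t b3 b4"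
    for e a n t b1 b2 b3 b4 :: nat
  \<comment> \<open>\<open>z\<close> codes \<open>(e, (x, b))\<close>, where \<open>x\<close> codes
    \<open>(a, (n, t))\<close> and \<open>b\<close> codes \<open>((b1, b2), (b3, b4))\<close>; each
    block of like quantifiers is thus contracted to one.\<close>
  define D where "D = {z. P (fst (prod_decode z))
     (fst (prod_decode (fst (prod_decode (snd (prod_decode z))))))
     (fst (prod_decode (snd (prod_decode (fst (prod_decode (snd (prod_decode z))))))))
     (snd (prod_decode (snd (prod_decode (fst (prod_decode (snd (prod_decode z))))))))
     (fst (prod_decode (fst (prod_decode (snd (prod_decode (snd (prod_decode z))))))))
     (snd (prod_decode (fst (prod_decode (snd (prod_decode (snd (prod_decode z))))))))
     (fst (prod_decode (snd (prod_decode (snd (prod_decode (snd (prod_decode z))))))))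
     (snd (prod_decode (snd (prod_decode (snd (prod_decode (snd (prod_decode z))))))))}"
  have "pr (\<lambda>z. z \<in> D)"
    unfolding D_def P_def mem_Collect_eq by (intro pr)
  then have "decidable D" by (rule pr_decidable)
  moreover have "e \<in> equality_problem d (subshift_of d B N) \<longleftrightarrow>
      (\<forall>x. \<exists>b. prod_encode (e, prod_encode (x, b)) \<in> D)" for e
  proof -
    have "e \<in> equality_problem d (subshift_of d B N) \<longleftrightarrow>
        (\<forall>a n t. \<exists>b1 b2 b3 b4. P e a n t b1 b2 b3 b4)"
      unfolding in_equality_problem_iff[OF N] P_def Let_def by blast
    also have "\<dots> \<longleftrightarrow> (\<forall>x. \<exists>b. P e (fst (prod_decode x)) (fst (prod_decode (snd (prod_decode x))))
        (snd (prod_decode (snd (prod_decode x)))) (fst (prod_decode (fst (prod_decode b))))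
        (snd (prod_decode (fst (prod_decode b)))) (fst (prod_decode (snd (prod_decode b))))
        (snd (prod_decode (snd (prod_decode b)))))" (is "?l \<longleftrightarrow> ?r")
    proof
      assume l: ?l
      show ?r
      proof
        fix x
        from l obtain b1 b2 b3 b4 where "P e (fst (prod_decode x)) (fst (prod_decode (snd (prod_decode x))))
          (snd (prod_decode (snd (prod_decode x)))) b1 b2 b3 b4" by blast
        then show "\<exists>b. P e (fst (prod_decode x)) (fst (prod_decode (snd (prod_decode x))))
          (snd (prod_decode (snd (prod_decode x)))) (fst (prod_decode (fst (prod_decode b))))
          (snd (prod_decode (fst (prod_decode b)))) (fst (prod_decode (snd (prod_decode b))))
          (snd (prod_decode (snd (prod_decode b))))"
          by (intro exI[of _ "prod_encode (prod_encode (b1, b2), prod_encode (b3, b4))"]) simp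
      qed
    next
      assume r: ?r
      show ?l
      proof (intro allI)
        fix a n t
        show "\<exists>b1 b2 b3 b4. P e a n t b1 b2 b3 b4"
          using r[rule_format, of "prod_encode (a, prod_encode (n, t))"] by auto
      qed
    qed
    also have "\<dots> \<longleftrightarrow> (\<forall>x. \<exists>b. prod_encode (e, prod_encode (x, b)) \<in> D)"
      by (simp add: D_def)
    finally show ?thesis .
  qed
  ultimately show ?thesis unfolding Pi2_def by blast
qed

section \<open>Hardness\<close>

text \<open>One bound \<open>t\<close> limits both the witnesses and the simulation time.
  Quantifying over list intervals makes the rules for lists applicable.\<close>

definition passes :: "tm \<Rightarrow> nat \<Rightarrow> nat \<Rightarrow> nat \<Rightarrow> bool" where
  "passes M n i t \<longleftrightarrow> (\<forall>a\<in>set [0..<Suc i]. \<exists>b\<in>set [0..<t]. \<exists>s\<in>set [0..<t].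
     result M (prod_encode (n, prod_encode (a, b))) s = Some 1)"

lemma pr_passes [pr]:
  assumes n: "pr n" and i: "pr i" and t: "pr t"
  shows "pr (\<lambda>x. passes M (n x) (i x) (t x))"
  unfolding passes_def by (intro pr pr_comp[OF n] pr_comp[OF t] assms)

text \<open>The lower bound \<open>t0\<close> allows the same \<open>t\<close> to be long enough for
  the run that outputs the pattern.\<close>

lemma passes_eventually:
  assumes D: "\<And>x. x \<in> D \<longleftrightarrow> (\<exists>t. result M x t = Some 1)"
    and n: "\<forall>a. \<exists>b. prod_encode (n, prod_encode (a, b)) \<in> D"
  obtains t where "t0 \<le> t" "passes M n i t"
proof -
  from n D have "\<forall>a. \<exists>b s. result M (prod_encode (n, prod_encode (a, b))) s = Some 1" by metis
  then obtain f g where fg: "\<And>a. result M (prod_encode (n, prod_encode (a, f a))) (g a) = Some 1"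
    by metis
  define t where "t = Suc (t0 + (\<Sum>a\<le>i. f a + g a))"
  have "f a < t \<and> g a < t" if "a \<le> i" for a
  proof -
    have "f a + g a \<le> (\<Sum>a\<le>i. f a + g a)"
      by (rule member_le_sum) (use that in auto)
    then show ?thesis by (simp add: t_def)
  qed
  then have "passes M n i t"
    unfolding passes_def using fg by (fastforce simp: less_Suc_eq_le)
  then show ?thesis by (intro that[of t]) (simp_all add: t_def)
qed

lemma passes_bounded:
  assumes D: "\<And>x. x \<in> D \<longleftrightarrow> (\<exists>t. result M x t = Some 1)"
    and a: "\<forall>b. prod_encode (n, prod_encode (a, b)) \<notin> D" and "passes M n i t"
  shows "i < a"
proof (rule ccontr)
  assume "\<not> i < a"
  then have "a \<in> set [0..<Suc i]" by auto
  with assms(3) obtain b s where "result M (prod_encode (n, prod_encode (a, b))) s = Some 1"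
    unfolding passes_def by blast
  then show False using D a by blast
qed

lemma finite_enumerated_initial: "finite {m. \<exists>i<a. \<exists>t. result N i t = Some m}"
proof -
  have "finite {m. tm_computes N i m}" for i
  proof (cases "\<exists>m. tm_computes N i m")
    case True
    then obtain m where "tm_computes N i m" ..
    then have "{m. tm_computes N i m} \<subseteq> {m}" using tm_computes_unique by blast
    then show ?thesis using finite_subset by blast
  qed simp
  then have "finite (\<Union>i\<in>{..<a}. {m. tm_computes N i m})" by blast
  moreover have "{m. \<exists>i<a. \<exists>t. result N i t = Some m} = (\<Union>i\<in>{..<a}. {m. tm_computes N i m})"
    by (auto simp: tm_computes_iff)
  ultimately show ?thesis by simp
qed

lemma hardness:
  assumes N: "specifies d A N" and not_SFT: "\<not> SFT d (subshift_of d A N)" and "Pi2 S"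
  obtains f where "computable f" "range f \<subseteq> effective_inputs d"
    "\<And>n. n \<in> S \<longleftrightarrow> f n \<in> equality_problem d (subshift_of d A N)"
proof -
  have A: "finite A" and pat: "enumerated_patterns N \<subseteq> patterns d A"
    using N by (auto simp: specifies_def)
  from \<open>Pi2 S\<close> obtain D where "decidable D"
    and S: "\<And>n. n \<in> S \<longleftrightarrow> (\<forall>a. \<exists>b. prod_encode (n, prod_encode (a, b)) \<in> D)"
    unfolding Pi2_def by blast
  from decidable_result[OF this(1)]
  obtain M where D: "\<And>x. x \<in> D \<longleftrightarrow> (\<exists>t. result M x t = Some 1)" by blast
  have not_finite: "\<not> finite F" if "F \<subseteq> enumerated N" "subshift_of d A N = avoiding d A (pattern_of ` F)" for F
  proof
    assume "finite F"
    moreover have "pattern_of ` F \<subseteq> patterns d A"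
      using that(1) pat by (auto simp: enumerated_patterns_def)
    ultimately have "SFT d (subshift_of d A N)"
      unfolding SFT_def using A that(2) by blast
    then show False using not_SFT by blast
  qed
  \<comment> \<open>With nothing forbidden, the subshift would be the full shift over
    \<open>A\<close>, which is an SFT.\<close>
  have "enumerated N \<noteq> {}"
    using not_finite[of "enumerated N"] by (auto simp: subshift_of_def enumerated_patterns_def)
  then obtain m0 where m0: "m0 \<in> enumerated N" by blast
  \<comment> \<open>The default \<open>m0\<close> is itself forbidden in the given subshift, so the
    new machine never forbids more than \<open>N\<close> does; this also keeps its outputs patterns
    over \<open>A\<close>.\<close>
  define h where "h n i t = (if passes M n i t
     then (case result N i t of None \<Rightarrow> m0 | Some m \<Rightarrow> m) else m0)" for n i t
  define g where "g z = h (fst (prod_decode z)) (fst (prod_decode (snd (prod_decode z))))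
     (snd (prod_decode (snd (prod_decode z))))" for z
  have "pr g" unfolding g_def h_def by (intro pr)
  then obtain T :: "nat \<Rightarrow> tm" where T: "pr T" "\<And>n j. tm_computes (T n) j (g (prod_encode (n, j)))"
    using parameter_theorem by blast
  have enum: "enumerated (T n) = {m. \<exists>i t. m = h n i t}" for n
  proof -
    have "enumerated (T n) = range (\<lambda>j. g (prod_encode (n, j)))"
      using T(2) tm_computes_unique unfolding enumerated_def by blast
    also have "\<dots> = {m. \<exists>i t. m = h n i t}"
      unfolding g_def by (auto simp: image_iff) (metis fst_conv prod_encode_inverse snd_conv)
    finally show ?thesis .
  qed
  have sub: "enumerated (T n) \<subseteq> enumerated N" for n
  proof -
    have "h n i t \<in> enumerated N" for i t
      using m0 in_enumerated_iff[of _ N] unfolding h_def by (cases "result N i t") auto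
    then show ?thesis unfolding enum by blast
  qed
  then have spec: "specifies d A (T n)" for n
    using A pat by (auto simp: specifies_def enumerated_patterns_def)
  have "subshift_of d A (T n) = subshift_of d A N" if "n \<in> S" for n
  proof -
    have "m \<in> enumerated (T n)" if "m \<in> enumerated N" for m
    proof -
      from that obtain i t0 where i: "result N i t0 = Some m" by (auto simp: in_enumerated_iff)
      obtain t where t: "t0 \<le> t" "passes M n i t"
        using passes_eventually[OF D] \<open>n \<in> S\<close> S by metis
      have "h n i t = m" using t(2) result_mono[OF i t(1)] by (simp add: h_def)
      then show ?thesis unfolding enum by blast
    qed
    then have "enumerated (T n) = enumerated N" using sub by blast
    then show ?thesis by (simp add: subshift_of_def enumerated_patterns_def)
  qed
  moreover have "subshift_of d A (T n) \<noteq> subshift_of d A N" if "n \<notin> S" for n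
  proof
    assume eq: "subshift_of d A (T n) = subshift_of d A N"
    from that S obtain a where "\<forall>b. prod_encode (n, prod_encode (a, b)) \<notin> D" by blast
    \<comment> \<open>Only inputs below the failing \<open>a\<close> can pass, each with at most one
      output of \<open>N\<close>. Finitely many forbidden patterns would then define the subshift
      and make it an SFT.\<close>
    from passes_bounded[OF D this]
    have "enumerated (T n) \<subseteq> insert m0 {m. \<exists>i<a. \<exists>t. result N i t = Some m}"
      unfolding enum h_def by (auto split: option.splits)
    then have "finite (enumerated (T n))"
      using finite_enumerated_initial finite_subset by blast
    then show False
      using not_finite[OF sub] eq by (simp add: subshift_of_def enumerated_patterns_def)
  qed
  ultimately have S_iff: "n \<in> S \<longleftrightarrow> subshift_of d A (T n) = subshift_of d A N" for n
    by blast
  define f where "f n = input_code A (T n)" for n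
  have "pr (\<lambda>n. prod_encode (set_encode A, encode (T n)))"
    by (intro pr T(1))
  then have "computable f"
    unfolding f_def input_code_def tm_code_encode by (rule pr_computable)
  moreover have "range f \<subseteq> effective_inputs d"
    using spec unfolding f_def effective_inputs_def by blast
  moreover have "f n \<in> equality_problem d (subshift_of d A N) \<longleftrightarrow> subshift_of d A (T n) = subshift_of d A N" for n
  proof
    assume "f n \<in> equality_problem d (subshift_of d A N)"
    then obtain A' M' where M': "input_code A (T n) = input_code A' M'" "specifies d A' M'"
      "subshift_of d A' M' = subshift_of d A N"
      unfolding f_def equality_problem_def by blast
    have "finite A'" using M'(2) by (simp add: specifies_def)
    then have "A' = A \<and> M' = T n"
      using input_code_iff[of A' "input_code A (T n)" M'] input_code_iff[of A "input_code A (T n)" "T n"] A M'(1)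
      by simp
    then show "subshift_of d A (T n) = subshift_of d A N" using M'(3) by simp
  next
    assume "subshift_of d A (T n) = subshift_of d A N"
    then show "f n \<in> equality_problem d (subshift_of d A N)"
      using spec unfolding f_def equality_problem_def by blast
  qed
  ultimately show ?thesis using S_iff by (intro that[of f]) auto
qed

theorem proposition7p4:
  fixes d :: nat and Y :: "(point \<Rightarrow> nat) set"
  assumes "d \<ge> 1" and "effective d Y" and "\<not> SFT d Y"
  shows "Pi2_complete_on (effective_inputs d) (equality_problem d Y)"
proof -
  from assms(2) obtain A N where N: "specifies d A N" "Y = subshift_of d A N"
    unfolding effective_def by blast
  have "equality_problem d Y \<subseteq> effective_inputs d"
    unfolding equality_problem_def effective_inputs_def by blast
  moreover have "Pi2 (equality_problem d Y)"
    unfolding N(2) by (rule Pi2_equality_problem[OF N(1)])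
  moreover have "\<exists>f. computable f \<and> range f \<subseteq> effective_inputs d \<and> (\<forall>n. n \<in> S \<longleftrightarrow> f n \<in> equality_problem d Y)"
    if "Pi2 S" for S
    using hardness[OF N(1) assms(3)[unfolded N(2)] that] unfolding N(2) by metis
  ultimately show ?thesis unfolding Pi2_complete_on_def by blast
qed

end
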